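(* Let $K\subset\mathbb{R}^n$ be a nonempty semi-algebraic set and let $F_l=(F_{l1},\dots,F_{ln}):K\to\mathbb{R}^n$, $l=1,\dots,m$, be maps all of whose components $F_{lj}$ are (restrictions to $K$ of) polynomials in $x_1,\dots,x_n$ with real coefficients. Then the proper Pareto solution set $\mathrm{Sol}^{pr}(\mathrm{PVVI})$ of the polynomial vector variational inequality defined by $F=(F_1,\dots,F_m)$ and $K$ is a semi-algebraic subset of $\mathbb{R}^n$. Consequently, it has finitely many connected components and each connected component is path connected.
   Context: A set in $\mathbb{R}^n$ is semi-algebraic if it is a finite union of sets of the form $\{x\in\mathbb{R}^n: f_1(x)=\dots=f_\ell(x)=0,\ g_{\ell+1}(x)<0,\dots,g_p(x)<0\}$ with all $f_i,g_j$ in $\mathbb{R}[x_1,\dots,x_n]$. Let $\Delta=\{(\xi_1,\dots,\xi_m)\in\mathbb{R}^m_+:\sum_{l=1}^m\xi_l=1\}$ be the standard simplex and $\mathrm{ri}\,\Delta=\{\xi\in\Delta:\xi_l>0,\ l=1,\dots,m\}$ its relative interior. For $\xi\in\Delta$ let $$\mathrm{Sol}(\mathrm{VI})_\xi=\Big\{x\in K:\ \Big\langle\sum_{l=1}^m\xi_lF_l(x),\,y-x\Big\rangle\ge 0\ \text{ for all } y\in K\Big\},$$ where $\langle\cdot,\cdot\rangle$ is the standard scalar product on $\mathbb{R}^n$. The proper Pareto solution set is $$\mathrm{Sol}^{pr}(\mathrm{PVVI})=\bigcup_{\xi\in\mathrm{ri}\,\Delta}\mathrm{Sol}(\mathrm{VI})_\xi.$$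 Connected components and path connectedness are with respect to the topology induced from $\mathbb{R}^n$. *)

theory Defs
  imports "HOL-Analysis.Analysis"
begin

text \<open>
  Elements of \<open>R[x_1,...,x_n]\<close> enter only through their values, so they are represented by the
  library predicate \<^const>\<open>real_polynomial_function\<close>: the functions generated by constants and
  (bounded) linear forms under sums and products. A linear form on \<open>real ^ 'n\<close> is a linear
  combination of the coordinates, so these are exactly the polynomial functions in
  \<open>x $ 1, ..., x $ n\<close>.
\<close>

definition basic_semialgebraic :: "(real ^ 'n) set \<Rightarrow> bool" where
  "basic_semialgebraic S \<longleftrightarrow>
    (\<exists>P Q. finite P \<and> finite Q \<and>
       (\<forall>f\<in>P. real_polynomial_function f) \<and> (\<forall>g\<in>Q. real_polynomial_function g) \<and>
       S = {x. (\<forall>f\<in>P. f x = 0) \<and> (\<forall>g\<in>Q. g x < 0)})"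

definition semialgebraic :: "(real ^ 'n) set \<Rightarrow> bool" where
  "semialgebraic S \<longleftrightarrow>
    (\<exists>\<B>. finite \<B> \<and> (\<forall>B\<in>\<B>. basic_semialgebraic B) \<and> S = \<Union>\<B>)"

text \<open>The restriction of \<open>f\<close> to \<open>K\<close> is polynomial; values outside \<open>K\<close> are irrelevant.\<close>

definition polynomial_on :: "(real ^ 'n) set \<Rightarrow> (real ^ 'n \<Rightarrow> real) \<Rightarrow> bool" where
  "polynomial_on K f \<longleftrightarrow> (\<exists>p. real_polynomial_function p \<and> (\<forall>x\<in>K. f x = p x))"

definition std_simplex :: "(real ^ 'm) set" where
  "std_simplex = {\<xi>. (\<forall>l. 0 \<le> \<xi> $ l) \<and> (\<Sum>l\<in>UNIV. \<xi> $ l) = 1}"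

definition ri_simplex :: "(real ^ 'm) set" where
  "ri_simplex = {\<xi> \<in> std_simplex. \<forall>l. 0 < \<xi> $ l}"

definition Sol_VI ::
  "('m \<Rightarrow> real ^ 'n \<Rightarrow> real ^ 'n) \<Rightarrow> (real ^ 'n) set \<Rightarrow> real ^ 'm \<Rightarrow> (real ^ 'n) set" where
  "Sol_VI F K \<xi> = {x \<in> K. \<forall>y\<in>K. (\<Sum>l\<in>UNIV. \<xi> $ l *\<^sub>R F l x) \<bullet> (y - x) \<ge> 0}"

definition Sol_pr ::
  "('m::finite \<Rightarrow> real ^ 'n \<Rightarrow> real ^ 'n) \<Rightarrow> (real ^ 'n) set \<Rightarrow> (real ^ 'n) set" where
  "Sol_pr F K = (\<Union>\<xi>\<in>ri_simplex. Sol_VI F K \<xi>)"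

end

theory Submission
  imports Defs "HOL-Computational_Algebra.Polynomial"
begin

text \<open>
  The proper Pareto set is given by a first-order formula over the reals: a point \<open>x\<close> belongs to
  it iff \<open>x \<in> K\<close> and there are positive weights \<open>w\<close> with sum \<open>1\<close> such that for all \<open>y \<in> K\<close> a certain
  polynomial in \<open>(x, w, y)\<close> is nonnegative. So semi-algebraicity is quantifier elimination, i.e. the
  theorem of Tarski and Seidenberg. For the topological part one needs that a semi-algebraic set is a
  finite union of path connected pieces, together with an argument that turns this into path
  connectedness of the components. Both facts about semi-algebraic sets are derived here from a
  single slicing theorem, proved by the method of Cohen and Hormander.

  \<^bold>\<open>Slicing.\<close> Let \<open>p x\<close> be finitely many real polynomials in one variable \<open>y\<close> whose coefficients are
  functions of \<open>x\<close> from a ring \<open>A\<close> of continuous functions. There are finitely many \<open>h \<in> A\<close> such that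
  over every set \<open>D\<close> on which all \<open>h\<close> have constant sign there are finitely many continuous functions
  \<open>r\<close> on \<open>D\<close>, in an order that does not depend on the point of \<open>D\<close>, such that the sign of \<open>p x y\<close>
  depends only on the position of \<open>y\<close> relative to the values \<open>r x\<close>. The given family is first closed
  under derivatives, under dropping leading terms and under pseudo-remainders (\<open>finite_level_closure\<close>),
  and the polynomials are then treated in order of their degree (\<open>slicing_step\<close>). At the roots of
  polynomials treated before, the sign of a new polynomial is that of a pseudo-remainder, up to the
  constant sign of a power of a leading coefficient, and
  between these roots the new polynomial is strictly monotone, because its derivative has been
  treated; hence the signs at the ends and at infinity decide whether it has a further root there, and
  that root is simple and so varies continuously (\<open>sign_transfer\<close>, \<open>root_section\<close>).

  \<^bold>\<open>Consequences.\<close> A set is called definable over \<open>A\<close> if membership depends only on the signs of finitely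
  many elements of \<open>A\<close>; over all polynomials these are the semi-algebraic sets
  (\<open>semialgebraic_iff_definable\<close>), and Boolean operations are immediate. To avoid an induction over
  the dimension of the space, which is a type, the space \<open>real ^ 'k\<close> is kept and the induction runs
  over the set \<open>I\<close> of the coordinates on which the polynomials may depend. If \<open>i \<notin> I\<close>, a polynomial
  in the coordinates \<open>insert i I\<close> is a polynomial in the coordinate \<open>i\<close> with coefficients in the
  polynomials in \<open>I\<close>. Slicing over the two-point sets \<open>{x, x'}\<close> gives closure under projection
  (\<open>definable_projection\<close>), and slicing over path connected sets cuts definable sets into finitely many
  path connected pieces (\<open>definable_finitely_path_connected\<close>).

  \<^bold>\<open>Components.\<close> If a point \<open>x\<close> of a semi-algebraic set \<open>S\<close> lies in the
  closure of a subset \<open>P\<close> of \<open>S\<close>, then, since \<open>S \<inter> ball x e\<close> has finitely many path connected pieces for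
  every \<open>e\<close>, one finds pieces shrinking to \<open>x\<close>, each meeting the next one, and concatenates infinitely
  many paths to a path from a point of \<open>P\<close> to \<open>x\<close> (\<open>path_component_of_closure_point\<close>). Thus path
  components are relatively closed and so are their complements, and they coincide with the
  components (\<open>components_path_connected_finite\<close>).
\<close>

section \<open>Position relative to finitely many sections\<close>

definition same_position :: "('x \<Rightarrow> real) set \<Rightarrow> 'x \<Rightarrow> real \<Rightarrow> 'x \<Rightarrow> real \<Rightarrow> bool" where
  "same_position R x y x' y' \<longleftrightarrow> (\<forall>r\<in>R. sgn (y - r x) = sgn (y' - r x'))"

lemma same_position_refl [simp]: "same_position R x y x y"
  by (simp add: same_position_def)

lemma same_position_sym: "same_position R x y x' y' \<Longrightarrow> same_position R x' y' x y"
  by (simp add: same_position_def)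

lemma same_position_trans:
  "same_position R x y x' y' \<Longrightarrow> same_position R x' y' x'' y'' \<Longrightarrow> same_position R x y x'' y''"
  by (simp add: same_position_def)

lemma same_position_mono: "same_position R x y x' y' \<Longrightarrow> S \<subseteq> R \<Longrightarrow> same_position S x y x' y'"
  by (auto simp: same_position_def)

lemma same_position_less: "same_position R x y x' y' \<Longrightarrow> r \<in> R \<Longrightarrow> r x < y \<longleftrightarrow> r x' < y'"
  unfolding same_position_def by (smt (verit) sgn_greater)

lemma same_position_greater: "same_position R x y x' y' \<Longrightarrow> r \<in> R \<Longrightarrow> y < r x \<longleftrightarrow> y' < r x'"
  unfolding same_position_def by (smt (verit) sgn_less)

lemma same_position_eq: "same_position R x y x' y' \<Longrightarrow> r \<in> R \<Longrightarrow> y = r x \<longleftrightarrow> y' = r x'"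
  unfolding same_position_def by (metis eq_iff_diff_eq_0 sgn_0_0)

lemma same_positionI:
  assumes "\<And>r. r \<in> R \<Longrightarrow> r x < y \<Longrightarrow> r x' < y'"
    and "\<And>r. r \<in> R \<Longrightarrow> y < r x \<Longrightarrow> y' < r x'"
    and "\<And>r. r \<in> R \<Longrightarrow> y = r x \<Longrightarrow> y' = r x'"
  shows "same_position R x y x' y'"
  unfolding same_position_def
proof
  fix r assume "r \<in> R"
  then show "sgn (y - r x) = sgn (y' - r x')"
    using assms[of r] by (cases "r x" y rule: linorder_cases) auto
qed

text \<open>
  A position is an intersection of half lines and points, so it is convex.
\<close>

lemma same_position_between:
  assumes "same_position R x y x' v" "same_position R x y x' w" "v \<le> u" "u \<le> w"
  shows "same_position R x y x' u"
proof (rule same_positionI)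
  fix r assume r: "r \<in> R"
  note * = same_position_less[OF assms(1) r] same_position_less[OF assms(2) r]
    same_position_greater[OF assms(1) r] same_position_greater[OF assms(2) r]
    same_position_eq[OF assms(1) r] same_position_eq[OF assms(2) r] assms(3,4)
  show "r x < y \<Longrightarrow> r x' < u" "y < r x \<Longrightarrow> u < r x'" "y = r x \<Longrightarrow> u = r x'"
    using * by auto
qed

lemma sgn_diff_less:
  fixes a b c d :: real
  assumes "sgn (a - b) = sgn (c - d)"
  shows "a < b \<longleftrightarrow> c < d" "a \<le> b \<longleftrightarrow> c \<le> d"
  using assms by (smt (verit) sgn_less sgn_greater)+

text \<open>
  The order of the sections is the same over all points of \<open>D\<close>. It is expressed by the signs of their
  differences, which allows different functions that agree on \<open>D\<close>.
\<close>

definition sections :: "'x::topological_space set \<Rightarrow> ('x \<Rightarrow> real) set \<Rightarrow> bool" where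
  "sections D R \<longleftrightarrow> finite R \<and> (\<forall>r\<in>R. continuous_on D r) \<and>
     (\<forall>r\<in>R. \<forall>s\<in>R. \<forall>x\<in>D. \<forall>x'\<in>D. sgn (r x - s x) = sgn (r x' - s x'))"

lemma finite_ex_max:
  fixes f :: "'b \<Rightarrow> real"
  assumes "finite U" "U \<noteq> {}"
  shows "\<exists>u\<in>U. \<forall>v\<in>U. f v \<le> f u"
proof -
  have "Max (f ` U) \<in> f ` U" using assms by simp
  then obtain u where "u \<in> U" "f u = Max (f ` U)" by auto
  then show ?thesis using assms by (metis Max_ge finite_imageI imageI)
qed

lemma finite_ex_min:
  fixes f :: "'b \<Rightarrow> real"
  assumes "finite U" "U \<noteq> {}"
  shows "\<exists>u\<in>U. \<forall>v\<in>U. f u \<le> f v"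
  using finite_ex_max[OF assms, of "\<lambda>u. - f u"] by simp

text \<open>
  Every position that occurs over one point of \<open>D\<close> occurs over all of them and is met by a continuous
  section: take the midpoint between the highest section below and the lowest section above. Since
  the order is constant, these two neighbours are the same functions over all of \<open>D\<close>. In this way the
  projection of a cell is the whole base, and the cells over a path connected base are path connected.
\<close>

lemma section_through:
  assumes R: "sections D R" and x0: "x0 \<in> D"
  shows "\<exists>m. continuous_on D m \<and> (\<forall>x\<in>D. same_position R x0 y0 x (m x))"
proof (cases "\<exists>r\<in>R. r x0 = y0")
  case True
  then obtain r where "r \<in> R" "r x0 = y0" by auto
  with R x0 show ?thesis
    unfolding sections_def same_position_def by (intro exI[of _ r]) blast
next
  case False
  have fin: "finite R" and cont: "\<And>r. r \<in> R \<Longrightarrow> continuous_on D r"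
    and ord: "\<And>r s x. r \<in> R \<Longrightarrow> s \<in> R \<Longrightarrow> x \<in> D \<Longrightarrow> sgn (r x0 - s x0) = sgn (r x - s x)"
    using R x0 unfolding sections_def by blast+
  \<comment> \<open>A bound for all sections replaces a missing neighbour below or above.\<close>
  define B where "B x = 1 + (\<Sum>r\<in>R. \<bar>r x\<bar>)" for x
  have contB: "continuous_on D B"
    unfolding B_def using cont by (intro continuous_intros) auto
  have B: "\<bar>r x\<bar> < B x" if "r \<in> R" for r x
    unfolding B_def using member_le_sum[OF that, of "\<lambda>r. \<bar>r x\<bar>"] fin by auto
  have B0: "0 < B x" for x
    unfolding B_def by (smt (verit) sum_nonneg abs_ge_zero)
  define U where "U = {r\<in>R. r x0 < y0}"
  define V where "V = {r\<in>R. y0 < r x0}"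
  have "\<exists>l. continuous_on D l \<and> (\<forall>r\<in>U. \<forall>x\<in>D. r x \<le> l x) \<and>
      (\<forall>r\<in>V. \<forall>x\<in>D. l x < r x) \<and> (\<forall>x. l x < B x)"
  proof (cases "U = {}")
    case True
    have "- B x < r x" if "r \<in> V" for r x using B[of r x] that V_def by auto
    moreover have "- B x < B x" for x using B0[of x] by simp
    ultimately show ?thesis
      using True contB by (intro exI[of _ "\<lambda>x. - B x"]) (auto intro!: continuous_intros)
  next
    case False
    have "finite U" using fin U_def by simp
    from finite_ex_max[OF this False, of "\<lambda>r. r x0"]
    obtain l where l: "l \<in> U" "\<And>r. r \<in> U \<Longrightarrow> r x0 \<le> l x0" by auto
    have lR: "l \<in> R" "l x0 < y0" using l U_def by auto
    have 1: "r x \<le> l x" if "r \<in> U" "x \<in> D" for r x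
      using sgn_diff_less(2)[OF ord[of r l x]] that l lR unfolding U_def by auto
    have 2: "l x < r x" if "r \<in> V" "x \<in> D" for r x
      using sgn_diff_less(1)[OF ord[of l r x]] that lR unfolding V_def by auto
    have 3: "l x < B x" for x using B[OF lR(1), of x] by simp
    from 1 2 3 show ?thesis using cont[OF lR(1)] by (intro exI[of _ l]) auto
  qed
  then obtain l where l: "continuous_on D l" "\<And>r x. r \<in> U \<Longrightarrow> x \<in> D \<Longrightarrow> r x \<le> l x"
      "\<And>r x. r \<in> V \<Longrightarrow> x \<in> D \<Longrightarrow> l x < r x" "\<And>x. l x < B x" by blast
  have "\<exists>u. continuous_on D u \<and> (\<forall>r\<in>V. \<forall>x\<in>D. u x \<le> r x) \<and> (\<forall>x\<in>D. l x < u x)"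
  proof (cases "V = {}")
    case True
    then show ?thesis using contB l(4) by (intro exI[of _ B]) auto
  next
    case False
    have "finite V" using fin V_def by simp
    from finite_ex_min[OF this False, of "\<lambda>r. r x0"]
    obtain u where u: "u \<in> V" "\<And>r. r \<in> V \<Longrightarrow> u x0 \<le> r x0" by auto
    have uR: "u \<in> R" using u V_def by auto
    have "u x \<le> r x" if "r \<in> V" "x \<in> D" for r x
      using sgn_diff_less(2)[OF ord[of u r x]] that u uR unfolding V_def by auto
    then show ?thesis using cont[OF uR] l(3)[OF u(1)] by (intro exI[of _ u]) auto
  qed
  then obtain u where u: "continuous_on D u" "\<And>r x. r \<in> V \<Longrightarrow> x \<in> D \<Longrightarrow> u x \<le> r x"
      "\<And>x. x \<in> D \<Longrightarrow> l x < u x" by blast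
  define m where "m x = (l x + u x) / 2" for x
  have "same_position R x0 y0 x (m x)" if x: "x \<in> D" for x
  proof (rule same_positionI)
    fix r assume r: "r \<in> R"
    show "r x < m x" if "r x0 < y0"
      using l(2)[of r x] u(3)[OF x] r x that unfolding U_def m_def by (auto simp: field_simps)
    show "m x < r x" if "y0 < r x0"
      using u(2)[of r x] u(3)[OF x] r x that unfolding V_def m_def by (auto simp: field_simps)
    show "m x = r x" if "y0 = r x0" using False r that by auto
  qed
  moreover have "continuous_on D m"
    unfolding m_def using l(1) u(1) by (intro continuous_intros) auto
  ultimately show ?thesis by blast
qed

text \<open>
  Let \<open>P\<close> and \<open>Q\<close> be two members, over \<open>x\<close> and \<open>x'\<close>, of a family of polynomials. If \<open>P\<close> increases on
  the gap between two sections and is nonnegative somewhere there, then it is positive at the upper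
  end of the gap, or has positive leading coefficient if the gap is unbounded. This is a sign that
  \<open>P\<close> and \<open>Q\<close> share, so \<open>Q\<close> is positive near the upper end of the corresponding gap.
\<close>

lemma sign_transfer_up:
  assumes fin: "finite R"
    and ord: "\<And>r s. r \<in> R \<Longrightarrow> s \<in> R \<Longrightarrow> sgn (r x - s x) = sgn (r x' - s x')"
    and sgns: "\<And>r. r \<in> R \<Longrightarrow> sgn (poly P (r x)) = sgn (poly Q (r x'))"
    and lead: "sgn (lead_coeff P) = sgn (lead_coeff Q)"
    and pos: "same_position R x y x' z" and off: "\<And>r. r \<in> R \<Longrightarrow> y \<noteq> r x"
    and incr: "\<And>w. same_position R x y x w \<Longrightarrow> poly (pderiv P) w > 0"
    and nonneg: "poly P y \<ge> 0"
  shows "\<exists>w. same_position R x' z x' w \<and> poly Q w > 0"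
proof (cases "\<exists>r\<in>R. y < r x")
  case True
  define V where "V = {r\<in>R. y < r x}"
  have "finite V" "V \<noteq> {}" using fin True V_def by auto
  from finite_ex_min[OF this, of "\<lambda>r. r x"]
  obtain u where u: "u \<in> V" "\<And>r. r \<in> V \<Longrightarrow> u x \<le> r x" by auto
  have uR: "u \<in> R" "y < u x" using u V_def by auto
  obtain c where c: "y < c" "c < u x" "poly P (u x) - poly P y = (u x - y) * poly (pderiv P) c"
    using poly_MVT[OF uR(2)] by blast
  have "same_position R x y x c"
    using c u(2) off unfolding V_def by (intro same_positionI) (auto, force)
  from incr[OF this] have "poly P (u x) > 0" using c uR nonneg
    by (smt (verit) mult_pos_pos)
  with sgns[OF uR(1)] have "poly Q (u x') > 0" by (metis sgn_greater)
  moreover have "isCont (poly Q) (u x')" by simp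
  ultimately have "\<forall>\<^sub>F w in at (u x'). poly Q w > 0"
    unfolding isCont_def by (rule order_tendstoD(1)[rotated])
  then obtain d where d: "d > 0" "\<And>w. w \<noteq> u x' \<Longrightarrow> dist w (u x') < d \<Longrightarrow> poly Q w > 0"
    unfolding eventually_at by auto
  define w where "w = max z (u x' - d/2)"
  have zu: "z < u x'" using same_position_greater[OF pos uR(1)] uR(2) by simp
  have w: "z \<le> w" "w < u x'" "dist w (u x') < d"
    using zu d(1) unfolding w_def dist_real_def by auto
  have "same_position R x' z x' w"
  proof (rule same_positionI)
    fix r assume r: "r \<in> R"
    show "r x' < w" if "r x' < z" using that w by simp
    show "w < r x'" if "z < r x'"
    proof -
      have "r \<in> V" using that r same_position_greater[OF pos r] V_def by simp
      then have "u x \<le> r x" by (rule u(2))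
      then have "u x' \<le> r x'" using sgn_diff_less(2)[OF ord[OF uR(1) r]] by simp
      then show ?thesis using w by simp
    qed
    show "w = r x'" if "z = r x'" using that off[OF r] same_position_eq[OF pos r] by simp
  qed
  then show ?thesis using d(2)[of w] w by auto
next
  case False
  have above: "same_position R x y x w" if "w \<ge> y" for w
    using that False off by (intro same_positionI) auto
  have grow: "poly P v < poly P w" if vw: "y \<le> v" "v < w" for v w
  proof -
    obtain c where c: "v < c" "c < w" "poly P w - poly P v = (w - v) * poly (pderiv P) c"
      using poly_MVT[OF vw(2)] by blast
    then have "(w - v) * poly (pderiv P) c > 0"
      using incr[OF above, of c] vw by simp
    then show ?thesis using c(3) by simp
  qed
  have "lead_coeff P > 0"
  proof (rule ccontr)
    assume "\<not> lead_coeff P > 0"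
    moreover have "P \<noteq> 0" using incr[of y] by auto
    ultimately have "lead_coeff (- P) > 0" by (simp add: less_le)
    from poly_pinfty_gt_lc[OF this] obtain n where n: "\<And>w. w \<ge> n \<Longrightarrow> poly (-P) w \<ge> lead_coeff (-P)" by blast
    have "poly P (max n (y + 1)) > 0"
      using grow[of y "max n (y + 1)"] nonneg by (simp add: less_max_iff_disj)
    with n[of "max n (y+1)"] \<open>lead_coeff (- P) > 0\<close> show False by simp
  qed
  with lead have "lead_coeff Q > 0" by (metis sgn_greater)
  from poly_pinfty_gt_lc[OF this] obtain n where n: "\<And>w. w \<ge> n \<Longrightarrow> poly Q w \<ge> lead_coeff Q" by blast
  have "r x' < z" if "r \<in> R" for r
    using same_position_less[OF pos that] False off[OF that] that by force
  then have "same_position R x' z x' (max z n)"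
    by (intro same_positionI) (auto simp: less_max_iff_disj, force+)
  moreover have "poly Q (max z n) > 0" using n[of "max z n"] \<open>lead_coeff Q > 0\<close> by simp
  ultimately show ?thesis by blast
qed

text \<open>
  The previous lemma for the reflected polynomials \<open>- P (- y)\<close> and \<open>- Q (- y)\<close> and the sections
  \<open>- r\<close>. As the degrees agree, both leading coefficients are multiplied by the same sign.
\<close>

lemma sign_transfer_down:
  assumes fin: "finite R"
    and ord: "\<And>r s. r \<in> R \<Longrightarrow> s \<in> R \<Longrightarrow> sgn (r x - s x) = sgn (r x' - s x')"
    and sgns: "\<And>r. r \<in> R \<Longrightarrow> sgn (poly P (r x)) = sgn (poly Q (r x'))"
    and deg: "degree P = degree Q"
    and lead: "sgn (lead_coeff P) = sgn (lead_coeff Q)"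
    and pos: "same_position R x y x' z" and off: "\<And>r. r \<in> R \<Longrightarrow> y \<noteq> r x"
    and incr: "\<And>w. same_position R x y x w \<Longrightarrow> poly (pderiv P) w > 0"
    and nonpos: "poly P y \<le> 0"
  shows "\<exists>w. same_position R x' z x' w \<and> poly Q w < 0"
proof -
  define flip :: "real poly \<Rightarrow> real poly" where "flip p = - pcompose p [:0, -1:]" for p
  define R' where "R' = (\<lambda>r x. - r x) ` R"
  have pos_flip: "same_position R' a (-b) a' (-b') \<longleftrightarrow> same_position R a b a' b'" for a b a' b'
  proof -
    have "sgn (- b + r a) = sgn (- b' + r a') \<longleftrightarrow> sgn (b - r a) = sgn (b' - r a')" for r
      using sgn_minus[of "b - r a"] sgn_minus[of "b' - r a'"] by (auto simp: algebra_simps)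
    then show ?thesis by (simp add: same_position_def R'_def)
  qed
  have lc: "lead_coeff (flip p) = - (lead_coeff p * (-1) ^ degree p)" for p
  proof -
    have "degree (flip p) = degree (pcompose p [:0, -1:])" unfolding flip_def by simp
    then have "lead_coeff (flip p) = - lead_coeff (pcompose p [:0, -1:])" by (simp add: flip_def)
    also have "\<dots> = - (lead_coeff p * (-1) ^ degree p)" by (subst lead_coeff_comp) auto
    finally show ?thesis .
  qed
  have ev: "poly (flip p) w = - poly p (- w)" for p w by (simp add: flip_def poly_pcompose)
  have dv: "poly (pderiv (flip p)) w = poly (pderiv p) (- w)" for p w
    by (simp add: flip_def pderiv_pcompose poly_pcompose pderiv_minus pderiv_pCons)
  have "\<exists>w. same_position R' x' (-z) x' w \<and> poly (flip Q) w > 0"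
  proof (rule sign_transfer_up[where P = "flip P" and x = x and y = "-y"])
    show "finite R'" using fin R'_def by simp
    show "sgn (r x - s x) = sgn (r x' - s x')" if "r \<in> R'" "s \<in> R'" for r s
    proof -
      from that obtain r1 s1 where "r1 \<in> R" "s1 \<in> R" "r = (\<lambda>x. - r1 x)" "s = (\<lambda>x. - s1 x)"
        unfolding R'_def by auto
      then show ?thesis using ord[of s1 r1] by (simp add: algebra_simps)
    qed
    show "sgn (poly (flip P) (r x)) = sgn (poly (flip Q) (r x'))" if "r \<in> R'" for r
      using that sgns unfolding R'_def by (auto simp: ev sgn_minus)
    show "sgn (lead_coeff (flip P)) = sgn (lead_coeff (flip Q))"
      using lead deg by (simp add: lc sgn_minus sgn_mult)
    show "same_position R' x (-y) x' (-z)" using pos pos_flip by simp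
    show "- y \<noteq> r x" if "r \<in> R'" for r using that off unfolding R'_def by auto
    show "poly (pderiv (flip P)) w > 0" if "same_position R' x (-y) x w" for w
      using incr[of "-w"] that pos_flip[of x y x "-w"] by (simp add: dv)
    show "0 \<le> poly (flip P) (- y)" using nonpos by (simp add: ev)
  qed
  then obtain w where "same_position R' x' (-z) x' w" "poly (flip Q) w > 0" by blast
  then show ?thesis using pos_flip[of x' z x' "-w"] by (intro exI[of _ "-w"]) (auto simp: ev)
qed

text \<open>
  On a gap on which \<open>P\<close> is strictly monotone, every sign taken by \<open>P\<close> is also taken by \<open>Q\<close> on the
  corresponding gap. A zero of \<open>P\<close> forces both strict signs of \<open>Q\<close>, and the intermediate value theorem
  yields a zero of \<open>Q\<close>.
\<close>

lemma sign_transfer: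
  assumes fin: "finite R"
    and ord: "\<And>r s. r \<in> R \<Longrightarrow> s \<in> R \<Longrightarrow> sgn (r x - s x) = sgn (r x' - s x')"
    and sgns: "\<And>r. r \<in> R \<Longrightarrow> sgn (poly P (r x)) = sgn (poly Q (r x'))"
    and deg: "degree P = degree Q"
    and lead: "sgn (lead_coeff P) = sgn (lead_coeff Q)"
    and pos: "same_position R x y x' z" and off: "\<And>r. r \<in> R \<Longrightarrow> y \<noteq> r x"
    and mono: "\<And>w. same_position R x y x w \<Longrightarrow> sgn (poly (pderiv P) w) = s" and s: "s \<noteq> 0"
  shows "\<exists>w. same_position R x' z x' w \<and> sgn (poly Q w) = sgn (poly P y)"
proof -
  have *: "\<exists>w. same_position R x' z x' w \<and> sgn (poly Q w) = sgn (poly P y)"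
    if sgns: "\<And>r. r \<in> R \<Longrightarrow> sgn (poly P (r x)) = sgn (poly Q (r x'))"
    and deg: "degree P = degree Q"
    and lead: "sgn (lead_coeff P) = sgn (lead_coeff Q)"
    and incr: "\<And>w. same_position R x y x w \<Longrightarrow> poly (pderiv P) w > 0" for P Q
  proof -
    have up: "\<exists>w. same_position R x' z x' w \<and> poly Q w > 0" if "poly P y \<ge> 0"
      using sign_transfer_up[where R = R and x = x and y = y and x' = x' and z = z and P = P and Q = Q]
        fin ord sgns lead pos off incr that by blast
    have down: "\<exists>w. same_position R x' z x' w \<and> poly Q w < 0" if "poly P y \<le> 0"
      using sign_transfer_down[where R = R and x = x and y = y and x' = x' and z = z and P = P and Q = Q]
        fin ord sgns deg lead pos off incr that by blast
    consider "poly P y > 0" | "poly P y < 0" | "poly P y = 0" by linarith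
    then show ?thesis
    proof cases
      case 3
      then obtain v w where v: "same_position R x' z x' v" "poly Q v > 0"
        and w: "same_position R x' z x' w" "poly Q w < 0" using up down by auto
      have "\<exists>c. min v w \<le> c \<and> c \<le> max v w \<and> poly Q c = 0"
      proof (cases v w rule: linorder_cases)
        case less
        then show ?thesis using poly_IVT_neg[OF less v(2) w(2)] by (auto intro: less_imp_le)
      next
        case greater
        then show ?thesis using poly_IVT_pos[OF greater w(2) v(2)] by (auto intro: less_imp_le)
      qed (use v w in auto)
      then obtain c where c: "min v w \<le> c" "c \<le> max v w" "poly Q c = 0" by blast
      have "same_position R x' z x' c"
        using same_position_between[OF v(1) w(1), of c] same_position_between[OF w(1) v(1), of c] c
        by (cases "v \<le> w") auto
      then show ?thesis using c 3 by auto
    qed (use up down in \<open>auto\<close>)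
  qed
  have "s = sgn (poly (pderiv P) y)" using mono[of y] by simp
  with s consider "s = 1" | "s = -1" by (auto simp: sgn_real_def split: if_splits)
  then show ?thesis
  proof cases
    case 1
    show ?thesis
      by (rule *[OF sgns deg lead]) (use mono 1 in \<open>auto simp: sgn_1_pos\<close>)
  next
    case 2
    have "\<exists>w. same_position R x' z x' w \<and> sgn (poly (-Q) w) = sgn (poly (-P) y)"
      by (rule *) (use sgns deg lead mono 2 in \<open>auto simp: sgn_minus pderiv_minus sgn_1_neg\<close>)
    then show ?thesis by (simp add: sgn_minus)
  qed
qed

section \<open>Adjoining the roots of a polynomial\<close>

definition sign_adapted :: "'x set \<Rightarrow> ('x \<Rightarrow> real) set \<Rightarrow> ('x \<Rightarrow> real poly) \<Rightarrow> bool" where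
  "sign_adapted D R p \<longleftrightarrow>
    (\<forall>x\<in>D. \<forall>x'\<in>D. \<forall>y y'. same_position R x y x' y' \<longrightarrow> sgn (poly (p x) y) = sgn (poly (p x') y'))"

lemma sign_adaptedD:
  "sign_adapted D R p \<Longrightarrow> x \<in> D \<Longrightarrow> x' \<in> D \<Longrightarrow> same_position R x y x' y' \<Longrightarrow>
    sgn (poly (p x) y) = sgn (poly (p x') y')"
  by (auto simp: sign_adapted_def)

lemma sign_adapted_mono: "sign_adapted D R p \<Longrightarrow> R \<subseteq> S \<Longrightarrow> sign_adapted D S p"
  unfolding sign_adapted_def by (meson same_position_mono)

lemma sgn_eventually_const:
  fixes f :: "'b \<Rightarrow> real"
  assumes "(f \<longlongrightarrow> l) F" "l \<noteq> 0"
  shows "\<forall>\<^sub>F x in F. sgn (f x) = sgn l"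
proof (cases "l > 0")
  case True
  from order_tendstoD(1)[OF assms(1) True] show ?thesis
    by eventually_elim (use True in auto)
next
  case False
  then have "l < 0" using assms by simp
  from order_tendstoD(2)[OF assms(1) this] show ?thesis
    by eventually_elim (use \<open>l < 0\<close> in auto)
qed

lemma eventually_same_position_moving_base:
  assumes R: "sections D R" and x: "x \<in> D" and off: "\<forall>r\<in>R. w \<noteq> r x"
  shows "\<forall>\<^sub>F x' in at x within D. same_position R x w x' w"
proof -
  have "\<forall>\<^sub>F x' in at x within D. sgn (w - r x') = sgn (w - r x)" if r: "r \<in> R" for r
  proof (rule sgn_eventually_const)
    have "(r \<longlongrightarrow> r x) (at x within D)"
      using R r x unfolding sections_def continuous_on_def by blast
    then show "((\<lambda>x'. w - r x') \<longlongrightarrow> w - r x) (at x within D)" by (intro tendsto_intros)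
  qed (use off[rule_format, OF r] in simp)
  then have "\<forall>\<^sub>F x' in at x within D. \<forall>r\<in>R. sgn (w - r x') = sgn (w - r x)"
    using R unfolding sections_def by (intro eventually_ball_finite) auto
  then show ?thesis by eventually_elim (simp add: same_position_def)
qed

lemma same_position_open:
  assumes fin: "finite R" and off: "\<forall>r\<in>R. y \<noteq> r x"
  shows "\<exists>d>0. \<forall>w. \<bar>w - y\<bar> < d \<longrightarrow> same_position R x y x w"
proof -
  have "\<forall>\<^sub>F w in nhds y. sgn (w - r x) = sgn (y - r x)" if r: "r \<in> R" for r
    using off[rule_format, OF r] by (intro sgn_eventually_const tendsto_intros filterlim_ident) auto
  then have "\<forall>\<^sub>F w in nhds y. \<forall>r\<in>R. sgn (w - r x) = sgn (y - r x)"
    using fin by (intro eventually_ball_finite) auto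
  then obtain d where "d > 0" "\<And>w. dist w y < d \<Longrightarrow> \<forall>r\<in>R. sgn (w - r x) = sgn (y - r x)"
    unfolding eventually_nhds_metric by blast
  then show ?thesis
    unfolding same_position_def dist_real_def by metis
qed

lemma sections_insert:
  assumes R: "sections D R" and cont: "continuous_on D h"
    and ord: "\<And>x x' r. x \<in> D \<Longrightarrow> x' \<in> D \<Longrightarrow> r \<in> R \<Longrightarrow> sgn (h x - r x) = sgn (h x' - r x')"
  shows "sections D (insert h R)"
proof -
  have *: "sgn (r x - s x) = sgn (r x' - s x')"
    if "r \<in> insert h R" "s \<in> insert h R" "x \<in> D" "x' \<in> D" for r s x x'
  proof -
    have "sgn (r x - h x) = sgn (r x' - h x')" if "r \<in> R"
      using ord[OF \<open>x \<in> D\<close> \<open>x' \<in> D\<close> that] sgn_minus[of "h x - r x"] sgn_minus[of "h x' - r x'"] by simp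
    moreover have "sgn (r x - s x) = sgn (r x' - s x')" if "r \<in> R" "s \<in> R"
      using R that \<open>x \<in> D\<close> \<open>x' \<in> D\<close> unfolding sections_def by blast
    ultimately show ?thesis using that ord[OF that(3,4), of s] by auto
  qed
  show ?thesis
    unfolding sections_def
  proof (intro conjI ballI)
    show "finite (insert h R)" using R by (simp add: sections_def)
    show "continuous_on D r" if "r \<in> insert h R" for r
      using that R cont unfolding sections_def by blast
  qed (rule *)
qed

text \<open>
  The inductive situation of the slicing theorem: on \<open>D\<close> the polynomials \<open>p x\<close> have constant degree
  and constant sign of the leading coefficient, the sections \<open>R\<close> already control the signs of the
  derivative, and the sign of \<open>p\<close> is constant along each of them.
\<close>

locale root_slicing =
  fixes D :: "'x::topological_space set" and R :: "('x \<Rightarrow> real) set"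
    and p :: "'x \<Rightarrow> real poly" and n :: nat
  assumes R: "sections D R"
    and cont: "\<And>y. continuous_on D (\<lambda>x. poly (p x) y)"
    and deg: "\<And>x. x \<in> D \<Longrightarrow> degree (p x) = n" and n: "n \<ge> 1"
    and lead: "\<And>x x'. x \<in> D \<Longrightarrow> x' \<in> D \<Longrightarrow> sgn (lead_coeff (p x)) = sgn (lead_coeff (p x'))"
    and deriv: "sign_adapted D R (\<lambda>x. pderiv (p x))"
    and sgns: "\<And>r x x'. r \<in> R \<Longrightarrow> x \<in> D \<Longrightarrow> x' \<in> D \<Longrightarrow>
      sgn (poly (p x) (r x)) = sgn (poly (p x') (r x'))"
begin

lemma finR: "finite R"
  using R by (simp add: sections_def)

lemma ord: "r \<in> R \<Longrightarrow> s \<in> R \<Longrightarrow> x \<in> D \<Longrightarrow> x' \<in> D \<Longrightarrow> sgn (r x - s x) = sgn (r x' - s x')"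
  using R unfolding sections_def by blast

text \<open>
  The derivative has constant sign on a gap, and this sign is not zero, because a gap is open and
  nonempty and a nonzero polynomial has finitely many roots.
\<close>

lemma deriv_sign:
  assumes x0: "x0 \<in> D" and off: "\<forall>r\<in>R. y0 \<noteq> r x0"
  obtains s where "s \<noteq> 0"
    "\<And>x w. x \<in> D \<Longrightarrow> same_position R x0 y0 x w \<Longrightarrow> sgn (poly (pderiv (p x)) w) = s"
proof
  let ?s = "sgn (poly (pderiv (p x0)) y0)"
  show 1: "sgn (poly (pderiv (p x)) w) = ?s" if "x \<in> D" "same_position R x0 y0 x w" for x w
    using sign_adaptedD[OF deriv x0 that] by simp
  show "?s \<noteq> 0"
  proof
    assume s0: "?s = 0"
    obtain d where d: "d > 0" "\<And>w. \<bar>w - y0\<bar> < d \<Longrightarrow> same_position R x0 y0 x0 w"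
      using same_position_open[OF finR off] by blast
    have "{y0<..<y0 + d} \<subseteq> {w. poly (pderiv (p x0)) w = 0}"
    proof
      fix w assume "w \<in> {y0<..<y0 + d}"
      then have "same_position R x0 y0 x0 w" by (intro d(2)) auto
      from 1[OF x0 this] s0 show "w \<in> {w. poly (pderiv (p x0)) w = 0}" by (simp add: sgn_zero_iff)
    qed
    moreover have "infinite {y0<..<y0 + d}" using d(1) by simp
    ultimately have "pderiv (p x0) = 0" using poly_roots_finite finite_subset by blast
    then have "degree (p x0) = 0" by (simp add: pderiv_eq_0_iff)
    with deg[OF x0] n show False by simp
  qed
qed

lemma strictly_monotone_in_position:
  assumes s: "\<And>w. same_position R x0 y0 x w \<Longrightarrow> sgn (poly (pderiv (p x)) w) = s"
    and v: "same_position R x0 y0 x v" and w: "same_position R x0 y0 x w"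
  shows "sgn (poly (p x) w - poly (p x) v) = s * sgn (w - v)"
proof -
  have *: "sgn (poly (p x) b - poly (p x) a) = s"
    if ab: "same_position R x0 y0 x a" "same_position R x0 y0 x b" "a < b" for a b
  proof -
    obtain c where c: "a < c" "c < b" "poly (p x) b - poly (p x) a = (b - a) * poly (pderiv (p x)) c"
      using poly_MVT[OF ab(3)] by blast
    then have "sgn (poly (pderiv (p x)) c) = s"
      using same_position_between[OF ab(1,2)] by (intro s) simp
    then show ?thesis using c ab(3) by (simp add: sgn_mult)
  qed
  show ?thesis
  proof (cases v w rule: linorder_cases)
    case greater
    then have "sgn (poly (p x) v - poly (p x) w) = s" using * v w by blast
    then have "sgn (poly (p x) w - poly (p x) v) = - s"
      using sgn_minus[of "poly (p x) v - poly (p x) w"] by simp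
    then show ?thesis using greater by simp
  qed (use *[OF v w] in auto)
qed

lemma transfer:
  assumes x: "x \<in> D" "x' \<in> D" and pos: "same_position R x y x' z"
    and off: "\<forall>r\<in>R. y \<noteq> r x"
  shows "\<exists>w. same_position R x' z x' w \<and> sgn (poly (p x') w) = sgn (poly (p x) y)"
proof -
  obtain s where s: "s \<noteq> 0"
    "\<And>x' w. x' \<in> D \<Longrightarrow> same_position R x y x' w \<Longrightarrow> sgn (poly (pderiv (p x')) w) = s"
    using deriv_sign[OF x(1) off] by metis
  show ?thesis
  proof (rule sign_transfer[where R = R and x = x and y = y and s = s])
    show "sgn (r x - s x) = sgn (r x' - s x')" if "r \<in> R" "s \<in> R" for r s
      using ord that x by blast
    show "sgn (poly (p x) (r x)) = sgn (poly (p x') (r x'))" if "r \<in> R" for r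
      using sgns that x by blast
    show "degree (p x) = degree (p x')" using deg x by simp
    show "sgn (lead_coeff (p x)) = sgn (lead_coeff (p x'))" using lead x by blast
    show "sgn (poly (pderiv (p x)) w) = s" if "same_position R x y x w" for w
      using s(2) x(1) that by blast
    show "y \<noteq> r x" if "r \<in> R" for r using off that by blast
  qed (fact finR pos s(1))+
qed

text \<open>
  By \<open>transfer\<close>, a root in a gap over one point produces a root in the corresponding gap over every
  point of \<open>D\<close>. Since \<open>p x\<close> is strictly monotone on the gap, the sign of \<open>w - \<eta> x\<close> is, up to a constant
  factor, the sign of \<open>p x\<close> at \<open>w\<close>, which for fixed \<open>w\<close> does not change under small changes of \<open>x\<close>; this
  gives continuity of the root \<open>\<eta>\<close>.
\<close>

lemma root_section:
  assumes x0: "x0 \<in> D" and off: "\<forall>r\<in>R. y0 \<noteq> r x0" and root: "poly (p x0) y0 = 0"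
  shows "\<exists>\<eta>. \<eta> x0 = y0 \<and> sections D (insert \<eta> R) \<and>
    (\<forall>x\<in>D. poly (p x) (\<eta> x) = 0 \<and> same_position R x0 y0 x (\<eta> x))"
proof -
  obtain s where s: "s \<noteq> 0"
    "\<And>x' w. x' \<in> D \<Longrightarrow> same_position R x0 y0 x' w \<Longrightarrow> sgn (poly (pderiv (p x')) w) = s"
    using deriv_sign[OF x0 off] by metis
  obtain m where m: "\<And>x. x \<in> D \<Longrightarrow> same_position R x0 y0 x (m x)"
    using section_through[OF R x0] by blast
  have "\<forall>x\<in>D. \<exists>w. same_position R x0 y0 x w \<and> poly (p x) w = 0"
  proof
    fix x assume x: "x \<in> D"
    from transfer[OF x0 x m[OF x] off] root
    obtain w where "same_position R x (m x) x w" "poly (p x) w = 0"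
      by (auto simp: sgn_zero_iff)
    then show "\<exists>w. same_position R x0 y0 x w \<and> poly (p x) w = 0"
      using same_position_trans[OF m[OF x], of x w] by blast
  qed
  then obtain \<eta> where \<eta>: "\<And>x. x \<in> D \<Longrightarrow> same_position R x0 y0 x (\<eta> x)"
    "\<And>x. x \<in> D \<Longrightarrow> poly (p x) (\<eta> x) = 0" by metis
  have sg: "sgn (poly (p x) w) = s * sgn (w - \<eta> x)" if "x \<in> D" "same_position R x0 y0 x w" for x w
    using strictly_monotone_in_position[OF s(2)[OF that(1)] \<eta>(1)[OF that(1)] that(2)] \<eta>(2)[OF that(1)]
    by simp
  have "\<eta> x0 = y0"
    using sg[OF x0 same_position_refl] root s(1) by (simp add: sgn_zero_iff)
  moreover have cont_\<eta>: "continuous_on D \<eta>"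
    unfolding continuous_on_def
  proof
    fix x assume x: "x \<in> D"
    have off': "\<forall>r\<in>R. \<eta> x \<noteq> r x"
      using same_position_eq[OF \<eta>(1)[OF x]] off by blast
    obtain d where d: "d > 0" "\<And>w. \<bar>w - \<eta> x\<bar> < d \<Longrightarrow> same_position R x (\<eta> x) x w"
      using same_position_open[OF finR off'] by blast
    \<comment> \<open>Points close to \<open>\<eta> x\<close> stay on the same side of the root when \<open>x\<close> moves a little.\<close>
    have side: "\<forall>\<^sub>F x' in at x within D. sgn (w - \<eta> x') = sgn (w - \<eta> x)"
      if w: "\<bar>w - \<eta> x\<bar> < d" "w \<noteq> \<eta> x" for w
    proof -
      have wx: "same_position R x0 y0 x w" by (rule same_position_trans[OF \<eta>(1)[OF x] d(2)[OF w(1)]])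
      have woff: "\<forall>r\<in>R. w \<noteq> r x"
        using same_position_eq[OF wx] off by blast
      have "poly (p x) w \<noteq> 0" using sg[OF x wx] w(2) s(1) by (auto simp: sgn_zero_iff)
      then have "\<forall>\<^sub>F x' in at x within D. sgn (poly (p x') w) = sgn (poly (p x) w)"
        using cont[of w] x unfolding continuous_on_def by (intro sgn_eventually_const) auto
      moreover have "\<forall>\<^sub>F x' in at x within D. x' \<in> D"
        by (simp add: eventually_at_topological) blast
      ultimately show ?thesis
        using eventually_same_position_moving_base[OF R x woff]
      proof eventually_elim
        case (elim x')
        have "same_position R x0 y0 x' w" by (rule same_position_trans[OF wx elim(3)])
        from sg[OF elim(2) this] sg[OF x wx] elim(1) s(1) show ?case by simp
      qed
    qed
    show "(\<eta> \<longlongrightarrow> \<eta> x) (at x within D)"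
    proof (rule tendstoI)
      fix e :: real assume e: "e > 0"
      define c where "c = min d e / 2"
      have c: "c > 0" "c < d" "c < e" using d(1) e unfolding c_def by auto
      have "\<forall>\<^sub>F x' in at x within D. sgn ((\<eta> x - c) - \<eta> x') = sgn ((\<eta> x - c) - \<eta> x)"
        by (rule side) (use c in auto)
      moreover have "\<forall>\<^sub>F x' in at x within D. sgn ((\<eta> x + c) - \<eta> x') = sgn ((\<eta> x + c) - \<eta> x)"
        by (rule side) (use c in auto)
      ultimately show "\<forall>\<^sub>F x' in at x within D. dist (\<eta> x') (\<eta> x) < e"
      proof eventually_elim
        case (elim x')
        have "\<eta> x - c < \<eta> x'" using elim(1) c by (simp add: sgn_real_def split: if_splits)
        moreover have "\<eta> x' < \<eta> x + c" using elim(2) c by (simp add: sgn_real_def split: if_splits)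
        ultimately show ?case using c by (simp add: dist_real_def)
      qed
    qed
  qed
  moreover have "sections D (insert \<eta> R)"
  proof (rule sections_insert[OF R cont_\<eta>])
    show "sgn (\<eta> x - r x) = sgn (\<eta> x' - r x')" if "x \<in> D" "x' \<in> D" "r \<in> R" for x x' r
      using \<eta>(1)[OF that(1)] \<eta>(1)[OF that(2)] that(3) unfolding same_position_def by metis
  qed
  ultimately show ?thesis using \<eta> by blast
qed

text \<open>
  If all roots lie on the sections, \<open>p\<close> has a constant sign on every gap over a fixed point, and by
  \<open>transfer\<close> opposite signs over two points would force a root inside a gap.
\<close>

lemma sign_adapted_if_no_new_roots:
  assumes none: "\<And>x y. x \<in> D \<Longrightarrow> poly (p x) y = 0 \<Longrightarrow> \<exists>r\<in>R. y = r x"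
  shows "sign_adapted D R p"
proof -
  have half: "poly (p x') y' > 0"
    if x: "x \<in> D" "x' \<in> D" and pos: "same_position R x y x' y'"
      and off: "\<forall>r\<in>R. y \<noteq> r x" and gt: "poly (p x) y > 0" for x x' y y'
  proof (rule ccontr)
    assume "\<not> poly (p x') y' > 0"
    moreover have off': "\<forall>r\<in>R. y' \<noteq> r x'"
      using same_position_eq[OF pos] off by blast
    moreover have "poly (p x') y' \<noteq> 0" using none[OF x(2), of y'] off' by blast
    ultimately have lt: "poly (p x') y' < 0" by simp
    obtain w where w: "same_position R x' y' x' w" "poly (p x') w > 0"
      using transfer[OF x pos off] gt by (auto simp: sgn_1_pos)
    have "\<exists>c. min y' w \<le> c \<and> c \<le> max y' w \<and> poly (p x') c = 0"
    proof (cases y' w rule: linorder_cases)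
      case less
      then show ?thesis using poly_IVT_pos[OF less lt w(2)] by (auto intro: less_imp_le)
    next
      case greater
      then show ?thesis using poly_IVT_neg[OF greater w(2) lt] by (auto intro: less_imp_le)
    qed (use lt w in auto)
    then obtain c where c: "min y' w \<le> c" "c \<le> max y' w" "poly (p x') c = 0" by blast
    have "same_position R x' y' x' c"
      using same_position_between[OF same_position_refl w(1), of c]
        same_position_between[OF w(1) same_position_refl, of c] c
      by (cases "y' \<le> w") auto
    moreover obtain r where "r \<in> R" "c = r x'" using none[OF x(2) c(3)] by blast
    ultimately show False using same_position_eq off' by metis
  qed
  show ?thesis unfolding sign_adapted_def
  proof (intro ballI allI impI)
    fix x x' y y' assume x: "x \<in> D" "x' \<in> D" and pos: "same_position R x y x' y'"
    show "sgn (poly (p x) y) = sgn (poly (p x') y')"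
    proof (cases "\<exists>r\<in>R. y = r x")
      case True
      then obtain r where "r \<in> R" "y = r x" "y' = r x'" using same_position_eq[OF pos] by blast
      then show ?thesis using sgns[OF _ x, of r] by simp
    next
      case False
      then have off: "\<forall>r\<in>R. y \<noteq> r x" "\<forall>r\<in>R. y' \<noteq> r x'"
        using same_position_eq[OF pos] by auto
      have "poly (p x) y \<noteq> 0" "poly (p x') y' \<noteq> 0" using none[OF x(1), of y] none[OF x(2), of y'] off by blast+
      moreover have "poly (p x) y > 0 \<longleftrightarrow> poly (p x') y' > 0"
        using half[OF x pos off(1)] half[OF x(2,1) same_position_sym[OF pos] off(2)] by blast
      ultimately show ?thesis by (auto simp: sgn_real_def)
    qed
  qed
qed

end

text \<open>
  Roots outside the present sections are adjoined one at a time. A root over any point of \<open>D\<close> gives a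
  section through a root over \<open>x0\<close> that was not met before, so the number of uncovered roots over the
  fixed point \<open>x0\<close> decreases.
\<close>

lemma root_slicing_complete:
  assumes "root_slicing D R p n" "x0 \<in> D"
  shows "\<exists>R'. R \<subseteq> R' \<and> sections D R' \<and> sign_adapted D R' p \<and>
    (\<forall>r\<in>R' - R. \<forall>x\<in>D. poly (p x) (r x) = 0)"
  using assms(1)
proof (induction "card {y. poly (p x0) y = 0 \<and> (\<forall>r\<in>R. y \<noteq> r x0)}" arbitrary: R rule: less_induct)
  case less
  interpret root_slicing D R p n by (rule less.prems)
  show ?case
  proof (cases "\<exists>x\<in>D. \<exists>y. poly (p x) y = 0 \<and> (\<forall>r\<in>R. y \<noteq> r x)")
    case False
    then have "sign_adapted D R p" by (intro sign_adapted_if_no_new_roots) blast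
    then show ?thesis using R by (intro exI[of _ R]) auto
  next
    case True
    then obtain x y where xy: "x \<in> D" "poly (p x) y = 0" "\<forall>r\<in>R. y \<noteq> r x" by blast
    from root_section[OF xy(1,3,2)] obtain \<eta> where \<eta>: "sections D (insert \<eta> R)"
      "\<And>x. x \<in> D \<Longrightarrow> poly (p x) (\<eta> x) = 0" "\<And>x'. x' \<in> D \<Longrightarrow> same_position R x y x' (\<eta> x')" by blast
    have new: "root_slicing D (insert \<eta> R) p n"
    proof
      show "sign_adapted D (insert \<eta> R) (\<lambda>x. pderiv (p x))"
        using sign_adapted_mono[OF deriv] by blast
      show "sgn (poly (p x) (r x)) = sgn (poly (p x') (r x'))"
        if "r \<in> insert \<eta> R" "x \<in> D" "x' \<in> D" for r x x'
        using that sgns[of r x x'] \<eta>(2) by (cases "r = \<eta>") auto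
      show "sgn (lead_coeff (p x)) = sgn (lead_coeff (p x'))" if "x \<in> D" "x' \<in> D" for x x'
        using that by (rule lead)
    qed (fact \<eta>(1) cont deg n | use deg in blast)+
    have "\<eta> x0 \<noteq> r x0" if "r \<in> R" for r
      using same_position_eq[OF \<eta>(3)[OF assms(2)] that] xy(3) that by simp
    then have "{y. poly (p x0) y = 0 \<and> (\<forall>r\<in>insert \<eta> R. y \<noteq> r x0)} \<subset>
        {y. poly (p x0) y = 0 \<and> (\<forall>r\<in>R. y \<noteq> r x0)}"
      using \<eta>(2)[OF assms(2)] by blast
    moreover have "p x0 \<noteq> 0" using deg[OF assms(2)] n by auto
    then have "finite {y. poly (p x0) y = 0 \<and> (\<forall>r\<in>R. y \<noteq> r x0)}"
      using poly_roots_finite[of "p x0"] by (auto intro: finite_subset[rotated])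
    ultimately have "card {y. poly (p x0) y = 0 \<and> (\<forall>r\<in>insert \<eta> R. y \<noteq> r x0)} <
        card {y. poly (p x0) y = 0 \<and> (\<forall>r\<in>R. y \<noteq> r x0)}"
      by (intro psubset_card_mono)
    from less.hyps[OF this new] obtain R' where
      "insert \<eta> R \<subseteq> R'" "sections D R'" "sign_adapted D R' p"
      "\<forall>r\<in>R' - insert \<eta> R. \<forall>x\<in>D. poly (p x) (r x) = 0" by blast
    then show ?thesis using \<eta>(2) by (intro exI[of _ R']) blast
  qed
qed

section \<open>Polynomials with coefficients in a ring of functions\<close>

lemma poly_as_sum_le:
  fixes p :: "real poly"
  assumes "degree p \<le> n"
  shows "poly p y = (\<Sum>k\<le>n. coeff p k * y ^ k)"
  unfolding poly_altdef
  by (rule sum.mono_neutral_left) (use assms in \<open>auto simp: coeff_eq_0\<close>)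

locale function_ring =
  fixes A :: "('x::topological_space \<Rightarrow> real) set"
  assumes const: "(\<lambda>_. c) \<in> A"
    and add: "f \<in> A \<Longrightarrow> g \<in> A \<Longrightarrow> (\<lambda>x. f x + g x) \<in> A"
    and mult: "f \<in> A \<Longrightarrow> g \<in> A \<Longrightarrow> (\<lambda>x. f x * g x) \<in> A"
    and continuous: "f \<in> A \<Longrightarrow> continuous_on S f"
begin

lemma sum: "finite I \<Longrightarrow> (\<And>i. i \<in> I \<Longrightarrow> f i \<in> A) \<Longrightarrow> (\<lambda>x. \<Sum>i\<in>I. f i x) \<in> A"
  by (induction I rule: finite_induct) (auto intro: add const)

lemma diff: "f \<in> A \<Longrightarrow> g \<in> A \<Longrightarrow> (\<lambda>x. f x - g x) \<in> A"
  using add[of f "\<lambda>x. (-1) * g x"] mult[OF const[of "-1"]] by simp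

text \<open>
  A polynomial over the ring \<open>A\<close> is represented by its specialisations to the points \<open>x\<close>. The number
  \<open>n\<close> is a formal degree: over some points the coefficient of index \<open>n\<close> may vanish.
\<close>

definition param_poly :: "nat \<Rightarrow> ('x \<Rightarrow> real poly) \<Rightarrow> bool" where
  "param_poly n p \<longleftrightarrow> (\<forall>x. degree (p x) \<le> n) \<and> (\<forall>k. (\<lambda>x. coeff (p x) k) \<in> A)"

lemma param_polyI:
  assumes "\<And>x k. k > n \<Longrightarrow> coeff (p x) k = 0" "\<And>k. (\<lambda>x. coeff (p x) k) \<in> A"
  shows "param_poly n p"
  using assms unfolding param_poly_def by (auto intro: degree_le)

lemma param_poly_coeff: "param_poly n p \<Longrightarrow> (\<lambda>x. coeff (p x) k) \<in> A"
  by (simp add: param_poly_def)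

lemma param_poly_coeff_0: "param_poly n p \<Longrightarrow> k > n \<Longrightarrow> coeff (p x) k = 0"
  unfolding param_poly_def by (meson coeff_eq_0 le_less_trans)

lemma param_poly_mono: "param_poly n p \<Longrightarrow> n \<le> m \<Longrightarrow> param_poly m p"
  unfolding param_poly_def by (meson order_trans)

lemma param_poly_add:
  assumes "param_poly n p" "param_poly m q" shows "param_poly (max n m) (\<lambda>x. p x + q x)"
  using assms by (intro param_polyI) (auto intro: add param_poly_coeff simp: param_poly_coeff_0)

lemma param_poly_mult:
  assumes "param_poly n p" "param_poly m q" shows "param_poly (n + m) (\<lambda>x. p x * q x)"
  unfolding param_poly_def
proof (intro conjI allI)
  show "degree (p x * q x) \<le> n + m" for x
    using degree_mult_le[of "p x" "q x"] assms unfolding param_poly_def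
    by (meson add_mono order_trans)
  show "(\<lambda>x. coeff (p x * q x) k) \<in> A" for k
    unfolding coeff_mult using assms by (intro sum mult) (auto intro: param_poly_coeff)
qed

lemma continuous_param_poly:
  assumes "param_poly n p" shows "continuous_on D (\<lambda>x. poly (p x) y)"
proof -
  have "degree (p x) \<le> n" for x using assms by (simp add: param_poly_def)
  then have "(\<lambda>x. poly (p x) y) = (\<lambda>x. \<Sum>k\<le>n. coeff (p x) k * y ^ k)"
    by (intro ext poly_as_sum_le)
  moreover have "continuous_on D (\<lambda>x. \<Sum>k\<le>n. coeff (p x) k * y ^ k)"
    using param_poly_coeff[OF assms] continuous by (intro continuous_intros) auto
  ultimately show ?thesis by (simp only:)
qed

definition truncate_top :: "nat \<times> ('x \<Rightarrow> real poly) \<Rightarrow> nat \<times> ('x \<Rightarrow> real poly)" where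
  "truncate_top = (\<lambda>(n, p). (n - 1, \<lambda>x. p x - monom (coeff (p x) n) n))"

definition derivative :: "nat \<times> ('x \<Rightarrow> real poly) \<Rightarrow> nat \<times> ('x \<Rightarrow> real poly)" where
  "derivative = (\<lambda>(n, p). (n - 1, \<lambda>x. pderiv (p x)))"

lemma param_poly_truncate:
  assumes "param_poly n p" "n \<ge> 1" shows "param_poly (n - 1) (\<lambda>x. p x - monom (coeff (p x) n) n)"
proof (rule param_polyI)
  show "coeff (p x - monom (coeff (p x) n) n) k = 0" if "k > n - 1" for x k
    using that param_poly_coeff_0[OF assms(1), of k x] assms(2) by (cases "k = n") auto
  show "(\<lambda>x. coeff (p x - monom (coeff (p x) n) n) k) \<in> A" for k
    using param_poly_coeff[OF assms(1)] const[of 0]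
    by (cases "k = n") (auto intro: diff)
qed

lemma param_poly_pderiv:
  assumes "param_poly n p" shows "param_poly (n - 1) (\<lambda>x. pderiv (p x))"
  using param_poly_coeff_0[OF assms] param_poly_coeff[OF assms] const
  by (intro param_polyI) (auto simp: coeff_pderiv intro!: mult)

definition is_pseudo_remainder ::
  "('x \<Rightarrow> real poly) \<Rightarrow> nat \<Rightarrow> ('x \<Rightarrow> real poly) \<Rightarrow> ('x \<Rightarrow> real poly) \<Rightarrow> bool" where
  "is_pseudo_remainder p m q r \<longleftrightarrow> param_poly (m - 1) r \<and>
    (\<exists>j. \<forall>x y. poly (q x) y = 0 \<longrightarrow> coeff (q x) m ^ j * poly (p x) y = poly (r x) y)"

text \<open>
  Division by \<open>q\<close> without denominators: the leading term of \<open>p\<close> is removed by subtracting a multiple of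
  \<open>q\<close> after multiplication with the leading coefficient of \<open>q\<close>. At a root of \<open>q\<close> the value of \<open>p\<close>, up to
  a power of that coefficient, is the value of the remainder. Only this property is recorded.
\<close>

lemma ex_pseudo_remainder:
  assumes q: "param_poly m q" and m: "m \<ge> 1" and p: "param_poly n p"
  shows "\<exists>r. is_pseudo_remainder p m q r"
  using p
proof (induction n arbitrary: p)
  case 0
  then show ?case unfolding is_pseudo_remainder_def
    using param_poly_mono[OF 0, of "m - 1"] by (intro exI[of _ p] conjI exI[of _ 0]) auto
next
  case (Suc n)
  show ?case
  proof (cases "Suc n < m")
    case True
    then show ?thesis unfolding is_pseudo_remainder_def
      using param_poly_mono[OF Suc.prems, of "m - 1"] by (intro exI[of _ p] conjI exI[of _ 0]) auto
  next
    case False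
    define d where "d = Suc n - m"
    define p' where "p' x = smult (coeff (q x) m) (p x) - monom (coeff (p x) (Suc n)) d * q x" for x
    have coeff_p': "coeff (p' x) k = coeff (q x) m * coeff (p x) k -
        (if k < d then 0 else coeff (p x) (Suc n) * coeff (q x) (k - d))" for x k
      unfolding p'_def by (simp add: coeff_monom_mult not_le)
    have "param_poly n p'"
    proof (rule param_polyI)
      show "coeff (p' x) k = 0" if "k > n" for x k
      proof (cases "k = Suc n")
        case True
        then have "k - d = m" "\<not> k < d" using False unfolding d_def by auto
        then show ?thesis using True by (simp add: coeff_p')
      next
        case neq: False
        then have "k - d > m" "k > Suc n" using that False unfolding d_def by auto
        then show ?thesis
          using param_poly_coeff_0[OF Suc.prems] param_poly_coeff_0[OF q] by (simp add: coeff_p')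
      qed
      show "(\<lambda>x. coeff (p' x) k) \<in> A" for k
        unfolding coeff_p' using param_poly_coeff[OF Suc.prems] param_poly_coeff[OF q] const
        by (cases "k < d") (auto intro!: diff mult)
    qed
    from Suc.IH[OF this] obtain r j where r: "param_poly (m - 1) r"
      "\<And>x y. poly (q x) y = 0 \<Longrightarrow> coeff (q x) m ^ j * poly (p' x) y = poly (r x) y"
      unfolding is_pseudo_remainder_def by blast
    have "coeff (q x) m ^ Suc j * poly (p x) y = poly (r x) y" if "poly (q x) y = 0" for x y
      using r(2)[OF that] that unfolding p'_def by (simp add: algebra_simps)
    then show ?thesis using r(1) unfolding is_pseudo_remainder_def by blast
  qed
qed

definition pseudo_remainder ::
  "nat \<times> ('x \<Rightarrow> real poly) \<Rightarrow> nat \<times> ('x \<Rightarrow> real poly) \<Rightarrow> nat \<times> ('x \<Rightarrow> real poly)" where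
  "pseudo_remainder = (\<lambda>(n, p) (m, q). (m - 1, SOME r. is_pseudo_remainder p m q r))"

lemma pseudo_remainder:
  assumes "param_poly n p" "param_poly m q" "m \<ge> 1"
  obtains r j where "pseudo_remainder (n, p) (m, q) = (m - 1, r)" "param_poly (m - 1) r"
    "\<And>x y. poly (q x) y = 0 \<Longrightarrow> coeff (q x) m ^ j * poly (p x) y = poly (r x) y"
proof -
  have "is_pseudo_remainder p m q (SOME r. is_pseudo_remainder p m q r)"
    using ex_pseudo_remainder[OF assms(2,3,1)] by (rule someI_ex)
  then show ?thesis using that unfolding is_pseudo_remainder_def pseudo_remainder_def by auto
qed

end

text \<open>
  If every operation \<open>f a b\<close> with \<open>lev b \<le> lev a\<close> yields results of lower level than \<open>b\<close>, a finite set
  has a finite closure: add the results for \<open>b\<close> of the top level, then those for \<open>b\<close> of the next lower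
  level, and so on. The elements added in a step have too low a level to enter an earlier step.
\<close>

lemma finite_level_closure:
  fixes lev :: "'a \<Rightarrow> nat" and f :: "'a \<Rightarrow> 'a \<Rightarrow> 'a set"
  assumes fin: "\<And>a b. finite (f a b)"
    and low: "\<And>a b c. V a \<Longrightarrow> V b \<Longrightarrow> 1 \<le> lev b \<Longrightarrow> lev b \<le> lev a \<Longrightarrow> c \<in> f a b \<Longrightarrow> lev c < lev b \<and> V c"
    and W: "finite W" "\<And>a. a \<in> W \<Longrightarrow> V a"
  shows "\<exists>W'. W \<subseteq> W' \<and> finite W' \<and> (\<forall>a\<in>W'. V a) \<and>
    (\<forall>a\<in>W'. \<forall>b\<in>W'. 1 \<le> lev b \<longrightarrow> lev b \<le> lev a \<longrightarrow> f a b \<subseteq> W')"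
proof -
  obtain N where N: "\<And>a. a \<in> W \<Longrightarrow> lev a \<le> N"
    using W(1) finite_nat_set_iff_bounded_le[of "lev ` W"] by auto
  \<comment> \<open>After \<open>j\<close> steps the set is closed with respect to all \<open>b\<close> of level above \<open>N - j\<close>.\<close>
  have "\<exists>W'. W \<subseteq> W' \<and> finite W' \<and> (\<forall>a\<in>W'. V a \<and> lev a \<le> N) \<and>
    (\<forall>a\<in>W'. \<forall>b\<in>W'. 1 \<le> lev b \<longrightarrow> N - j < lev b \<longrightarrow> lev b \<le> lev a \<longrightarrow> f a b \<subseteq> W')" for j
  proof (induction j)
    case 0
    show ?case using W N by (intro exI[of _ W]) (auto dest: leD)
  next
    case (Suc j)
    then obtain W' where W': "W \<subseteq> W'" "finite W'" "\<And>a. a \<in> W' \<Longrightarrow> V a" "\<And>a. a \<in> W' \<Longrightarrow> lev a \<le> N"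
      "\<And>a b. a \<in> W' \<Longrightarrow> b \<in> W' \<Longrightarrow> 1 \<le> lev b \<Longrightarrow> N - j < lev b \<Longrightarrow> lev b \<le> lev a \<Longrightarrow> f a b \<subseteq> W'" by blast
    define k where "k = N - j"
    define X where "X = (\<Union>(a, b)\<in>{(a, b). a \<in> W' \<and> b \<in> W' \<and> 1 \<le> lev b \<and> lev b = k \<and> lev b \<le> lev a}. f a b)"
    have X: "V c \<and> lev c < k" if "c \<in> X" for c
      using that low W'(3) unfolding X_def by blast
    have "finite X"
      unfolding X_def using fin W'(2)
      by (intro finite_UN_I) (auto intro: finite_subset[of _ "W' \<times> W'"])
    moreover have "f a b \<subseteq> W' \<union> X"
      if ab: "a \<in> W' \<union> X" "b \<in> W' \<union> X" "1 \<le> lev b" "N - Suc j < lev b" "lev b \<le> lev a" for a b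
    proof -
      have "k \<le> lev b" using ab(4) ab(3) unfolding k_def by simp
      then have *: "a \<in> W'" "b \<in> W'" using ab X by force+
      show ?thesis
      proof (cases "lev b = k")
        case True
        then show ?thesis using * ab unfolding X_def by blast
      next
        case False
        then have "N - j < lev b" using \<open>k \<le> lev b\<close> k_def by simp
        then show ?thesis using W'(5)[OF *] ab by blast
      qed
    qed
    moreover have "V a \<and> lev a \<le> N" if "a \<in> W' \<union> X" for a
      using that X[of a] W'(3,4) unfolding k_def by auto
    ultimately show ?case using W'(1,2) by (intro exI[of _ "W' \<union> X"]) auto
  qed
  from this[of N] show ?thesis by (auto simp: Suc_le_eq)
qed

section \<open>The slicing theorem\<close>

definition const_sign :: "('x \<Rightarrow> real) set \<Rightarrow> 'x set \<Rightarrow> bool" where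
  "const_sign H D \<longleftrightarrow> (\<forall>h\<in>H. \<forall>x\<in>D. \<forall>x'\<in>D. sgn (h x) = sgn (h x'))"

lemma const_signD:
  "const_sign H D \<Longrightarrow> h \<in> H \<Longrightarrow> x \<in> D \<Longrightarrow> x' \<in> D \<Longrightarrow> sgn (h x) = sgn (h x')"
  unfolding const_sign_def by blast

context function_ring begin

definition reductions ::
  "nat \<times> ('x \<Rightarrow> real poly) \<Rightarrow> nat \<times> ('x \<Rightarrow> real poly) \<Rightarrow> (nat \<times> ('x \<Rightarrow> real poly)) set" where
  "reductions a b = insert (pseudo_remainder a b) (if a = b then {truncate_top a, derivative a} else {})"

lemma reductions_lower:
  assumes a: "param_poly (fst a) (snd a)" and b: "param_poly (fst b) (snd b)" "1 \<le> fst b"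
    and c: "c \<in> reductions a b"
  shows "fst c < fst b \<and> param_poly (fst c) (snd c)"
proof -
  obtain n p m q where ab: "a = (n, p)" "b = (m, q)" by fastforce
  have n: "param_poly n p" and m: "param_poly m q" "1 \<le> m" using a b by (auto simp: ab)
  obtain r where r: "pseudo_remainder a b = (m - 1, r)" "param_poly (m - 1) r"
    using pseudo_remainder[OF n m] unfolding ab by metis
  from c consider "c = pseudo_remainder a b" | "c = truncate_top b" | "c = derivative b"
    unfolding reductions_def by (auto split: if_splits)
  then show ?thesis
  proof cases
    case 1
    then show ?thesis using r m by (simp add: ab)
  next
    case 2
    then show ?thesis using param_poly_truncate[OF m] m(2) by (simp add: ab truncate_top_def)
  next
    case 3
    then show ?thesis using param_poly_pderiv[OF m(1)] m(2) by (simp add: ab derivative_def)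
  qed
qed

text \<open>
  Over \<open>D\<close> all coefficients of the closed family \<open>W\<close> have constant sign. Let \<open>Z\<close> be the part of \<open>W\<close>
  treated so far, containing everything of formal degree below \<open>n\<close>, and let \<open>p\<close> have formal degree
  \<open>n\<close>. If the coefficient of index \<open>n\<close> vanishes, \<open>p\<close> equals its truncation, which is in \<open>Z\<close>. Otherwise
  \<open>n\<close> is the true degree; the derivative is in \<open>Z\<close>, and each section \<open>r \<in> R\<close> is a root of some \<open>q \<in> Z\<close>
  with nonvanishing leading coefficient, so that the sign of \<open>p\<close> along \<open>r\<close> is determined by the
  pseudo-remainder of \<open>p\<close> by \<open>q\<close>, which is in \<open>Z\<close> as well.
\<close>

lemma slicing_step:
  assumes W: "\<And>n p. (n, p) \<in> W \<Longrightarrow> param_poly n p"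
    and closed: "\<And>a b. a \<in> W \<Longrightarrow> b \<in> W \<Longrightarrow> 1 \<le> fst b \<Longrightarrow> fst b \<le> fst a \<Longrightarrow> reductions a b \<subseteq> W"
    and sgn_coeff: "\<And>m q x x' k. (m, q) \<in> W \<Longrightarrow> x \<in> D \<Longrightarrow> x' \<in> D \<Longrightarrow>
      sgn (coeff (q x) k) = sgn (coeff (q x') k)"
    and x0: "x0 \<in> D"
    and Z: "Z \<subseteq> W" "\<And>a. a \<in> W \<Longrightarrow> fst a < n \<Longrightarrow> a \<in> Z" "\<And>a. a \<in> Z \<Longrightarrow> fst a \<le> n"
    and p: "(n, p) \<in> W"
    and R: "sections D R" "\<And>m q. (m, q) \<in> Z \<Longrightarrow> sign_adapted D R q"
      "\<And>r. r \<in> R \<Longrightarrow> \<exists>m q. (m, q) \<in> Z \<and> 1 \<le> m \<and> (\<forall>x\<in>D. coeff (q x) m \<noteq> 0 \<and> poly (q x) (r x) = 0)"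
  shows "\<exists>R'. R \<subseteq> R' \<and> sections D R' \<and> sign_adapted D R' p \<and>
      (\<forall>r\<in>R' - R. 1 \<le> n \<and> (\<forall>x\<in>D. coeff (p x) n \<noteq> 0 \<and> poly (p x) (r x) = 0))"
proof -
  have nz: "coeff (q x) k = 0 \<longleftrightarrow> coeff (q x') k = 0"
    if "(m, q) \<in> W" "x \<in> D" "x' \<in> D" for m q x x' k
    using sgn_coeff[OF that, of k] by (metis sgn_zero_iff)
  have pn: "param_poly n p" using W p by blast
  consider (vanish) "coeff (p x0) n = 0" "n \<ge> 1" | (const) "n = 0" | (main) "coeff (p x0) n \<noteq> 0" "n \<ge> 1"
    by linarith
  then show ?thesis
  proof cases
    case vanish
    have "truncate_top (n, p) \<in> W" using closed[OF p p] vanish(2) unfolding reductions_def by auto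
    then have "truncate_top (n, p) \<in> Z" using Z(2) vanish(2) unfolding truncate_top_def by simp
    then have "sign_adapted D R (\<lambda>x. p x - monom (coeff (p x) n) n)"
      using R(2) unfolding truncate_top_def by auto
    moreover have "coeff (p x) n = 0" if "x \<in> D" for x using nz[OF p x0 that] vanish by simp
    ultimately have "sign_adapted D R p" unfolding sign_adapted_def by simp
    then show ?thesis using R(1) by (intro exI[of _ R]) auto
  next
    case const
    have eval: "poly (p x) y = coeff (p x) 0" for x y
      using pn const unfolding param_poly_def by (simp add: poly_as_sum_le[of _ 0])
    then have "sign_adapted D R p"
      unfolding sign_adapted_def eval using sgn_coeff[OF p] by blast
    then show ?thesis using R(1) by (intro exI[of _ R]) auto
  next
    case main
    have lc: "coeff (p x) n \<noteq> 0" if "x \<in> D" for x using nz[OF p x0 that] main by simp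
    have deg: "degree (p x) = n" if "x \<in> D" for x
      using pn lc[OF that] unfolding param_poly_def by (simp add: le_antisym le_degree)
    have "root_slicing D R p n"
    proof
      show "sections D R" by (fact R(1))
      show "continuous_on D (\<lambda>x. poly (p x) y)" for y by (rule continuous_param_poly[OF pn])
      show "degree (p x) = n" if "x \<in> D" for x by (rule deg[OF that])
      show "n \<ge> 1" by (fact main)
      show "sgn (lead_coeff (p x)) = sgn (lead_coeff (p x'))" if "x \<in> D" "x' \<in> D" for x x'
        using sgn_coeff[OF p that, of n] deg that by simp
      have "derivative (n, p) \<in> W" using closed[OF p p] main unfolding reductions_def by auto
      then have "derivative (n, p) \<in> Z" using Z(2) main unfolding derivative_def by simp
      then show "sign_adapted D R (\<lambda>x. pderiv (p x))" using R(2) unfolding derivative_def by auto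
      show "sgn (poly (p x) (r x)) = sgn (poly (p x') (r x'))"
        if r: "r \<in> R" and x: "x \<in> D" "x' \<in> D" for r x x'
      proof -
        obtain m q where q: "(m, q) \<in> Z" "1 \<le> m"
          "\<And>x. x \<in> D \<Longrightarrow> coeff (q x) m \<noteq> 0" "\<And>x. x \<in> D \<Longrightarrow> poly (q x) (r x) = 0"
          using R(3)[OF r] by blast
        have qW: "(m, q) \<in> W" using q Z(1) by auto
        obtain s j where s: "pseudo_remainder (n, p) (m, q) = (m - 1, s)"
          "\<And>x y. poly (q x) y = 0 \<Longrightarrow> coeff (q x) m ^ j * poly (p x) y = poly (s x) y"
          using pseudo_remainder[OF pn W[OF qW] q(2)] by metis
        have "m \<le> n" using Z(3)[OF q(1)] by simp
        then have "(m - 1, s) \<in> W"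
          using closed[OF p qW] q(2) s(1) unfolding reductions_def by auto
        then have "(m - 1, s) \<in> Z" using Z(2) q(2) \<open>m \<le> n\<close> by simp
        then have "sign_adapted D R s" by (rule R(2))
        moreover have "same_position R x (r x) x' (r x')"
          using R(1) r x unfolding sections_def same_position_def by blast
        ultimately have "sgn (poly (s x) (r x)) = sgn (poly (s x') (r x'))"
          using x by (intro sign_adaptedD)
        then have "sgn (coeff (q x) m) ^ j * sgn (poly (p x) (r x)) =
            sgn (coeff (q x') m) ^ j * sgn (poly (p x') (r x'))"
          unfolding s(2)[OF q(4)[OF x(1)], symmetric] s(2)[OF q(4)[OF x(2)], symmetric]
            sgn_mult power_sgn[symmetric] .
        moreover have "sgn (coeff (q x) m) = sgn (coeff (q x') m)" by (rule sgn_coeff[OF qW x])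
        moreover have "sgn (coeff (q x') m) \<noteq> 0" using q(3)[OF x(2)] by (simp add: sgn_zero_iff)
        ultimately show ?thesis by simp
      qed
    qed
    from root_slicing_complete[OF this x0] main(2) lc show ?thesis by blast
  qed
qed

text \<open>
  The functions \<open>H\<close> are the coefficients of the closure of the given family. The members of the closure
  are treated in the order of their formal degrees.
\<close>

theorem slicing:
  assumes W0: "finite W0" "\<And>n p. (n, p) \<in> W0 \<Longrightarrow> param_poly n p"
  shows "\<exists>H. finite H \<and> H \<subseteq> A \<and> (\<forall>D. const_sign H D \<longrightarrow>
    (\<exists>R. sections D R \<and> (\<forall>(n, p)\<in>W0. sign_adapted D R p)))"
proof -
  have "\<exists>W. W0 \<subseteq> W \<and> finite W \<and> (\<forall>a\<in>W. param_poly (fst a) (snd a)) \<and>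
    (\<forall>a\<in>W. \<forall>b\<in>W. 1 \<le> fst b \<longrightarrow> fst b \<le> fst a \<longrightarrow> reductions a b \<subseteq> W)"
  proof (rule finite_level_closure[where V = "\<lambda>a. param_poly (fst a) (snd a)"])
    show "finite (reductions a b)" for a b by (simp add: reductions_def)
    show "fst c < fst b \<and> param_poly (fst c) (snd c)"
      if "param_poly (fst a) (snd a)" "param_poly (fst b) (snd b)" "1 \<le> fst b" "c \<in> reductions a b"
      for a b c
      using that by (rule reductions_lower)
    show "param_poly (fst a) (snd a)" if "a \<in> W0" for a
      using W0(2)[of "fst a" "snd a"] that by simp
  qed (fact W0(1))
  then obtain W where W12: "W0 \<subseteq> W" "finite W"
    and valid: "\<And>a. a \<in> W \<Longrightarrow> param_poly (fst a) (snd a)"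
    and closed: "\<And>a b. a \<in> W \<Longrightarrow> b \<in> W \<Longrightarrow> 1 \<le> fst b \<Longrightarrow> fst b \<le> fst a \<Longrightarrow> reductions a b \<subseteq> W"
    by blast
  have "param_poly n p" if "(n, p) \<in> W" for n p using valid[OF that] by simp
  note W = W12 this
  define H where "H = (\<Union>(n, p)\<in>W. (\<lambda>k x. coeff (p x) k) ` {..n})"
  have "finite H" unfolding H_def using W(2) by auto
  moreover have "H \<subseteq> A" unfolding H_def using param_poly_coeff[OF W(3)] by auto
  moreover have "\<exists>R. sections D R \<and> (\<forall>(n, p)\<in>W0. sign_adapted D R p)" if D: "const_sign H D" for D
  proof (cases "D = {}")
    case True
    then show ?thesis by (intro exI[of _ "{}"]) (auto simp: sections_def sign_adapted_def)
  next
    case False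
    then obtain x0 where x0: "x0 \<in> D" by blast
    have sgn_coeff: "sgn (coeff (q x) k) = sgn (coeff (q x') k)"
      if "(m, q) \<in> W" "x \<in> D" "x' \<in> D" for m q x x' k
    proof (cases "k \<le> m")
      case True
      then have "(\<lambda>x. coeff (q x) k) \<in> H" unfolding H_def using that(1) by force
      from const_signD[OF D this that(2,3)] show ?thesis .
    qed (use W(3)[OF that(1)] param_poly_coeff_0 in auto)
    \<comment> \<open>Besides adaptedness the induction carries the fact that every section is a root of a treated
        polynomial with nonvanishing leading coefficient.\<close>
    define sliced where "sliced Z \<longleftrightarrow> (\<exists>R. sections D R \<and> (\<forall>(m, q)\<in>Z. sign_adapted D R q) \<and>
      (\<forall>r\<in>R. \<exists>(m, q)\<in>Z. 1 \<le> m \<and> (\<forall>x\<in>D. coeff (q x) m \<noteq> 0 \<and> poly (q x) (r x) = 0)))" for Z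
    have step: "sliced (insert (n, p) Z)"
      if Z: "Z \<subseteq> W" "\<And>a. a \<in> W \<Longrightarrow> fst a < n \<Longrightarrow> a \<in> Z" "\<And>a. a \<in> Z \<Longrightarrow> fst a \<le> n"
        and p: "(n, p) \<in> W" and "sliced Z" for Z n p
    proof -
      from \<open>sliced Z\<close> obtain R where R: "sections D R" "\<And>m q. (m, q) \<in> Z \<Longrightarrow> sign_adapted D R q"
        "\<And>r. r \<in> R \<Longrightarrow> \<exists>m q. (m, q) \<in> Z \<and> 1 \<le> m \<and> (\<forall>x\<in>D. coeff (q x) m \<noteq> 0 \<and> poly (q x) (r x) = 0)"
        unfolding sliced_def by blast
      have "\<exists>R'. R \<subseteq> R' \<and> sections D R' \<and> sign_adapted D R' p \<and>
          (\<forall>r\<in>R' - R. 1 \<le> n \<and> (\<forall>x\<in>D. coeff (p x) n \<noteq> 0 \<and> poly (p x) (r x) = 0))"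
        by (rule slicing_step[OF W(3) closed sgn_coeff x0 Z p R])
      then obtain R' where "R \<subseteq> R' \<and> sections D R' \<and> sign_adapted D R' p \<and>
          (\<forall>r\<in>R' - R. 1 \<le> n \<and> (\<forall>x\<in>D. coeff (p x) n \<noteq> 0 \<and> poly (p x) (r x) = 0))" ..
      then have R': "R \<subseteq> R'" "sections D R'" "sign_adapted D R' p"
        "\<And>r. r \<in> R' - R \<Longrightarrow> 1 \<le> n \<and> (\<forall>x\<in>D. coeff (p x) n \<noteq> 0 \<and> poly (p x) (r x) = 0)"
        by blast+
      have "\<exists>(m, q)\<in>insert (n, p) Z. 1 \<le> m \<and> (\<forall>x\<in>D. coeff (q x) m \<noteq> 0 \<and> poly (q x) (r x) = 0)"
        if "r \<in> R'" for r
        using that R(3)[of r] R'(4)[of r] by (cases "r \<in> R") blast+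
      then show ?thesis
        unfolding sliced_def using R' sign_adapted_mono[OF R(2) R'(1)] by (intro exI[of _ R']) auto
    qed
    have "sliced {a \<in> W. fst a < k}" for k
    proof (induction k)
      case 0
      show ?case unfolding sliced_def by (intro exI[of _ "{}"]) (auto simp: sections_def)
    next
      case (Suc k)
      have "sliced ({a \<in> W. fst a < k} \<union> S)" if "finite S" "S \<subseteq> {a \<in> W. fst a = k}" for S
        using that
      proof (induction S rule: finite_induct)
        case empty
        show ?case using Suc by simp
      next
        case (insert a S)
        obtain p where a: "a = (k, p)" using insert.prems by (cases a) auto
        have "sliced (insert (k, p) ({a \<in> W. fst a < k} \<union> S))"
          by (rule step) (use insert a in auto)
        then show ?case using a by simp
      qed
      from this[of "{a \<in> W. fst a = k}"] W(2)
      have "sliced ({a \<in> W. fst a < k} \<union> {a \<in> W. fst a = k})" by simp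
      also have "{a \<in> W. fst a < k} \<union> {a \<in> W. fst a = k} = {a \<in> W. fst a < Suc k}" by auto
      finally show ?case .
    qed
    moreover obtain N where "\<And>a. a \<in> W \<Longrightarrow> fst a < N"
      using W(2) finite_nat_set_iff_bounded[of "fst ` W"] by auto
    then have "{a \<in> W. fst a < N} = W" by auto
    ultimately have "sliced W" by metis
    then show ?thesis unfolding sliced_def using W(1) by blast
  qed
  ultimately show ?thesis by blast
qed

end

section \<open>Polynomials in some of the coordinates\<close>

definition upd :: "real ^ 'k \<Rightarrow> 'k \<Rightarrow> real \<Rightarrow> real ^ 'k" where
  "upd x i t = (\<chi> j. if j = i then t else x $ j)"

lemma upd_nth [simp]: "upd x i t $ j = (if j = i then t else x $ j)"
  by (simp add: upd_def)

lemma upd_triv [simp]: "upd x i (x $ i) = x"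
  by (simp add: vec_eq_iff)

text \<open>
  Polynomial functions on \<open>real ^ 'k\<close> that use only coordinates in \<open>I\<close>. They live on the full space for
  every \<open>I\<close>, so that an induction over \<open>I\<close> can replace an induction over the dimension.
\<close>

inductive_set poly_in :: "'k::finite set \<Rightarrow> (real ^ 'k \<Rightarrow> real) set" for I where
  const: "(\<lambda>_. c) \<in> poly_in I"
| coord: "i \<in> I \<Longrightarrow> (\<lambda>x. x $ i) \<in> poly_in I"
| add: "f \<in> poly_in I \<Longrightarrow> g \<in> poly_in I \<Longrightarrow> (\<lambda>x. f x + g x) \<in> poly_in I"
| mult: "f \<in> poly_in I \<Longrightarrow> g \<in> poly_in I \<Longrightarrow> (\<lambda>x. f x * g x) \<in> poly_in I"

lemma poly_in_mono: "f \<in> poly_in I \<Longrightarrow> I \<subseteq> J \<Longrightarrow> f \<in> poly_in J"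
  by (induction rule: poly_in.induct) (auto intro: poly_in.intros)

lemma poly_in_continuous: "f \<in> poly_in I \<Longrightarrow> continuous_on S f"
  by (induction rule: poly_in.induct) (auto intro!: continuous_intros)

lemma function_ring_poly_in: "function_ring (poly_in I)"
  by unfold_locales (auto intro: poly_in.intros poly_in_continuous)

lemma poly_in_cong: "f \<in> poly_in I \<Longrightarrow> (\<And>j. j \<in> I \<Longrightarrow> x $ j = y $ j) \<Longrightarrow> f x = f y"
  by (induction rule: poly_in.induct) auto

lemma poly_in_upd: "f \<in> poly_in I \<Longrightarrow> i \<notin> I \<Longrightarrow> f (upd x i t) = f x"
  by (erule poly_in_cong) auto

text \<open>
  A bounded linear form is the linear combination of the coordinates whose coefficients are its values
  at the unit vectors.
\<close>

lemma poly_in_UNIV: "poly_in UNIV = Collect real_polynomial_function"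
proof (intro equalityI subsetI)
  fix f :: "real ^ 'k \<Rightarrow> real" assume "f \<in> poly_in UNIV"
  then show "f \<in> Collect real_polynomial_function"
    by (induction rule: poly_in.induct)
      (auto intro: real_polynomial_function.intros bounded_linear_vec_nth)
next
  fix f :: "real ^ 'k \<Rightarrow> real" assume "f \<in> Collect real_polynomial_function"
  then have "real_polynomial_function f" by simp
  then show "f \<in> poly_in UNIV"
  proof (induction rule: real_polynomial_function.induct)
    case (linear f)
    interpret function_ring "poly_in (UNIV :: 'k set)" by (rule function_ring_poly_in)
    have "f = (\<lambda>x. \<Sum>j\<in>UNIV. x $ j * f (axis j 1))"
    proof
      fix x
      have "f x = f (\<Sum>j\<in>UNIV. x $ j *\<^sub>R axis j 1)"
        by (simp add: basis_expansion flip: scalar_mult_eq_scaleR)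
      also have "\<dots> = (\<Sum>j\<in>UNIV. x $ j * f (axis j 1))"
        using linear by (simp add: linear_sum linear_cmul bounded_linear.linear)
      finally show "f x = (\<Sum>j\<in>UNIV. x $ j * f (axis j 1))" .
    qed
    moreover have "(\<lambda>x. \<Sum>j\<in>UNIV. x $ j * f (axis j 1)) \<in> poly_in UNIV"
      by (intro sum mult poly_in.coord poly_in.const) auto
    ultimately show ?case by simp
  qed (auto intro: poly_in.intros)
qed

lemma poly_in_insert_param:
  assumes "f \<in> poly_in (insert i I)"
  shows "\<exists>n p. function_ring.param_poly (poly_in I) n p \<and> (\<forall>x. f x = poly (p x) (x $ i))"
proof -
  interpret function_ring "poly_in I" by (rule function_ring_poly_in)
  have base: "param_poly 0 (\<lambda>x. [:g x:])" if "g \<in> poly_in I" for g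
  proof (rule param_polyI)
    show "coeff [:g x:] k = 0" if "k > 0" for x k using that by (cases k) auto
    show "(\<lambda>x. coeff [:g x:] k) \<in> poly_in I" for k
      using \<open>g \<in> poly_in I\<close> const[of 0] by (cases k) auto
  qed
  show ?thesis using assms
  proof (induction rule: poly_in.induct)
    case (const c)
    show ?case by (intro exI[of _ 0] exI[of _ "\<lambda>_. [:c:]"]) (auto intro: base poly_in.const)
  next
    case (coord j)
    show ?case
    proof (cases "j = i")
      case True
      have "param_poly 1 (\<lambda>_. [:0, 1:])"
        using poly_in.const by (intro param_polyI) (auto simp: coeff_pCons split: nat.split)
      then show ?thesis using True by (intro exI[of _ 1] exI[of _ "\<lambda>_. [:0, 1:]"]) auto
    next
      case False
      then show ?thesis using coord
        by (intro exI[of _ 0] exI[of _ "\<lambda>x. [:x $ j:]"]) (auto intro: base poly_in.coord)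
    qed
  next
    case (add f g)
    then obtain n p m q where "param_poly n p" "param_poly m q"
      "\<And>x. f x = poly (p x) (x $ i)" "\<And>x. g x = poly (q x) (x $ i)" by metis
    then show ?case using param_poly_add by (intro exI[of _ "max n m"] exI[of _ "\<lambda>x. p x + q x"]) auto
  next
    case (mult f g)
    then obtain n p m q where "param_poly n p" "param_poly m q"
      "\<And>x. f x = poly (p x) (x $ i)" "\<And>x. g x = poly (q x) (x $ i)" by metis
    then show ?case using param_poly_mult by (intro exI[of _ "n + m"] exI[of _ "\<lambda>x. p x * q x"]) auto
  qed
qed

section \<open>Definable sets and their projections\<close>

definition definable :: "('x \<Rightarrow> real) set \<Rightarrow> 'x set \<Rightarrow> bool" where
  "definable A S \<longleftrightarrow> (\<exists>H. finite H \<and> H \<subseteq> A \<and>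
     (\<forall>x x'. (\<forall>h\<in>H. sgn (h x) = sgn (h x')) \<longrightarrow> x \<in> S \<longrightarrow> x' \<in> S))"

lemma definable_mono: "definable A S \<Longrightarrow> A \<subseteq> B \<Longrightarrow> definable B S"
  unfolding definable_def by blast

lemma definable_Compl:
  assumes "definable A S" shows "definable A (- S)"
proof -
  obtain H where "finite H" "H \<subseteq> A"
    "\<And>x x'. (\<forall>h\<in>H. sgn (h x) = sgn (h x')) \<Longrightarrow> x \<in> S \<Longrightarrow> x' \<in> S"
    using assms unfolding definable_def by blast
  moreover from this(3) have "x' \<in> - S" if "\<forall>h\<in>H. sgn (h x) = sgn (h x')" "x \<in> - S" for x x'
    using that by (metis ComplD ComplI)
  ultimately show ?thesis unfolding definable_def by blast
qed

lemma definable_Int: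
  assumes "definable A S" "definable A T" shows "definable A (S \<inter> T)"
proof -
  obtain G H where "finite G" "G \<subseteq> A" "finite H" "H \<subseteq> A"
    "\<And>x x'. (\<forall>h\<in>G. sgn (h x) = sgn (h x')) \<Longrightarrow> x \<in> S \<Longrightarrow> x' \<in> S"
    "\<And>x x'. (\<forall>h\<in>H. sgn (h x) = sgn (h x')) \<Longrightarrow> x \<in> T \<Longrightarrow> x' \<in> T"
    using assms unfolding definable_def by metis
  then show ?thesis unfolding definable_def by (intro exI[of _ "G \<union> H"]) (simp add: ball_Un, blast)
qed

lemma definable_UNIV: "definable A UNIV"
  unfolding definable_def by (intro exI[of _ "{}"]) auto

lemma definable_INT:
  "finite I \<Longrightarrow> (\<And>i. i \<in> I \<Longrightarrow> definable A (S i)) \<Longrightarrow> definable A (\<Inter>i\<in>I. S i)"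
  by (induction I rule: finite_induct) (auto intro: definable_UNIV definable_Int)

lemma definable_UN:
  assumes "finite I" "\<And>i. i \<in> I \<Longrightarrow> definable A (S i)"
  shows "definable A (\<Union>i\<in>I. S i)"
proof -
  have "definable A (- (\<Inter>i\<in>I. - S i))"
    using assms by (intro definable_Compl definable_INT)
  then show ?thesis by simp
qed

lemma definable_sgn: "a \<in> A \<Longrightarrow> definable A {x. sgn (a x) = s}"
  unfolding definable_def by (intro exI[of _ "{a}"]) auto

lemma definable_pos: "a \<in> A \<Longrightarrow> definable A {x. 0 < a x}"
  using definable_sgn[of a A 1] by (simp add: sgn_1_pos)

lemma definable_neg: "a \<in> A \<Longrightarrow> definable A {x. a x < 0}"
  using definable_sgn[of a A "-1"] by (simp add: sgn_1_neg)

lemma definable_zero: "a \<in> A \<Longrightarrow> definable A {x. a x = 0}"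
  using definable_sgn[of a A 0] by (simp add: sgn_zero_iff)

text \<open>
  The slicing theorem for polynomials in the coordinates \<open>insert i I\<close>, read as polynomials in the
  coordinate \<open>i\<close> over \<open>poly_in I\<close>. The coefficients do not change when \<open>x\<close> is replaced by \<open>upd x i y\<close>.
\<close>

lemma cylinder_slicing:
  fixes L :: "(real ^ 'k::finite \<Rightarrow> real) set"
  assumes L: "finite L" "L \<subseteq> poly_in (insert i I)" and i: "i \<notin> I"
  shows "\<exists>H. finite H \<and> H \<subseteq> poly_in I \<and> (\<forall>D. const_sign H D \<longrightarrow>
    (\<exists>R. sections D R \<and> (\<forall>x\<in>D. \<forall>x'\<in>D. \<forall>y y'. same_position R x y x' y' \<longrightarrow>
      (\<forall>f\<in>L. sgn (f (upd x i y)) = sgn (f (upd x' i y'))))))"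
proof -
  interpret function_ring "poly_in I" by (rule function_ring_poly_in)
  have "\<forall>f\<in>L. \<exists>w. param_poly (fst w) (snd w) \<and> (\<forall>x. f x = poly (snd w x) (x $ i))"
    using poly_in_insert_param[of _ i I] L(2) by (metis fst_conv snd_conv subsetD)
  then obtain w where w: "\<And>f. f \<in> L \<Longrightarrow> param_poly (fst (w f)) (snd (w f))"
    "\<And>f x. f \<in> L \<Longrightarrow> f x = poly (snd (w f) x) (x $ i)" by metis
  have ev: "f (upd x i y) = poly (snd (w f) x) y" if "f \<in> L" for f x y
  proof -
    have "snd (w f) (upd x i y) = snd (w f) x"
      using poly_in_upd[OF param_poly_coeff[OF w(1)[OF that]] i] by (intro poly_eqI)
    then show ?thesis using w(2)[OF that, of "upd x i y"] by simp
  qed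
  have "\<exists>H. finite H \<and> H \<subseteq> poly_in I \<and> (\<forall>D. const_sign H D \<longrightarrow>
    (\<exists>R. sections D R \<and> (\<forall>(n, p)\<in>w ` L. sign_adapted D R p)))"
  proof (rule slicing)
    show "param_poly n p" if "(n, p) \<in> w ` L" for n p
    proof -
      from that obtain f where "f \<in> L" "w f = (n, p)" by force
      then show ?thesis using w(1)[of f] by simp
    qed
  qed (use L(1) in simp)
  then obtain H where H: "finite H" "H \<subseteq> poly_in I" and
    R: "\<And>D. const_sign H D \<Longrightarrow> \<exists>R. sections D R \<and> (\<forall>(n, p)\<in>w ` L. sign_adapted D R p)" by blast
  have "\<exists>R. sections D R \<and> (\<forall>x\<in>D. \<forall>x'\<in>D. \<forall>y y'. same_position R x y x' y' \<longrightarrow>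
      (\<forall>f\<in>L. sgn (f (upd x i y)) = sgn (f (upd x' i y'))))" if D: "const_sign H D" for D
  proof -
    obtain R where R: "sections D R" "\<forall>(n, p)\<in>w ` L. sign_adapted D R p" using R[OF D] by blast
    have "sign_adapted D R (snd (w f))" if "f \<in> L" for f
      using R(2) that by (auto simp: case_prod_beta)
    then show ?thesis using R(1) ev unfolding sign_adapted_def by (intro exI[of _ R]) metis
  qed
  then show ?thesis using H by blast
qed

text \<open>
  If \<open>x\<close> and \<open>x'\<close> give the same signs to the slicing functions \<open>H\<close>, the two-point set \<open>{x, x'}\<close> can be
  sliced: a witness \<open>t\<close> over \<open>x\<close> can be moved to the same position over \<open>x'\<close>, where all polynomials
  defining \<open>S\<close> have the same signs. So membership in the projection depends only on the signs of \<open>H\<close>.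
\<close>

theorem definable_projection:
  fixes S :: "(real ^ 'k::finite) set"
  assumes S: "definable (poly_in (insert i I)) S" and i: "i \<notin> I"
  shows "definable (poly_in I) {x. \<exists>t. upd x i t \<in> S}"
proof -
  obtain L where L: "finite L" "L \<subseteq> poly_in (insert i I)"
    "\<And>x x'. (\<forall>h\<in>L. sgn (h x) = sgn (h x')) \<Longrightarrow> x \<in> S \<Longrightarrow> x' \<in> S"
    using S unfolding definable_def by blast
  obtain H where H: "finite H" "H \<subseteq> poly_in I" and
    R: "\<And>D. const_sign H D \<Longrightarrow> \<exists>R. sections D R \<and> (\<forall>x\<in>D. \<forall>x'\<in>D. \<forall>y y'. same_position R x y x' y' \<longrightarrow>
      (\<forall>f\<in>L. sgn (f (upd x i y)) = sgn (f (upd x' i y'))))"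
    using cylinder_slicing[OF L(1,2) i] by metis
  have "\<exists>t. upd x' i t \<in> S" if same: "\<forall>h\<in>H. sgn (h x) = sgn (h x')" and t: "upd x i t \<in> S" for x x' t
  proof -
    have "const_sign H {x, x'}" using same by (auto simp: const_sign_def)
    then obtain R where R: "sections {x, x'} R" "\<And>y y'. same_position R x y x' y' \<Longrightarrow>
      \<forall>f\<in>L. sgn (f (upd x i y)) = sgn (f (upd x' i y'))" using R by (metis insertCI)
    obtain m where "same_position R x t x' (m x')" using section_through[OF R(1), of x t] by auto
    from L(3)[OF R(2)[OF this] t] show ?thesis by blast
  qed
  then show ?thesis unfolding definable_def using H by (intro exI[of _ H]) blast
qed

lemma definable_ex_coordinates:
  fixes S :: "(real ^ 'k::finite) set"
  assumes "definable (poly_in UNIV) S"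
  shows "definable (poly_in UNIV) {x. \<exists>z\<in>S. \<forall>j. j \<notin> J \<longrightarrow> z $ j = x $ j}"
  using finite[of J]
proof (induction J rule: finite_induct)
  case empty
  have "{x. \<exists>z\<in>S. \<forall>j. j \<notin> {} \<longrightarrow> z $ j = x $ j} = S" by (auto simp: vec_eq_iff[symmetric])
  then show ?case using assms by simp
next
  case (insert i J)
  let ?T = "{x. \<exists>z\<in>S. \<forall>j. j \<notin> J \<longrightarrow> z $ j = x $ j}"
  have "insert i (UNIV - {i}) = UNIV" by auto
  then have "definable (poly_in (UNIV - {i})) {x. \<exists>t. upd x i t \<in> ?T}"
    using insert.IH by (intro definable_projection) auto
  then have "definable (poly_in UNIV) {x. \<exists>t. upd x i t \<in> ?T}"
    by (rule definable_mono) (auto intro: poly_in_mono)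
  also have "{x. \<exists>t. upd x i t \<in> ?T} = {x. \<exists>z\<in>S. \<forall>j. j \<notin> insert i J \<longrightarrow> z $ j = x $ j}"
  proof (intro equalityI subsetI)
    fix x assume "x \<in> {x. \<exists>z\<in>S. \<forall>j. j \<notin> insert i J \<longrightarrow> z $ j = x $ j}"
    then obtain z where z: "z \<in> S" "\<And>j. j \<notin> insert i J \<Longrightarrow> z $ j = x $ j" by blast
    then have "upd x i (z $ i) \<in> ?T" by (auto intro!: bexI[of _ z])
    then show "x \<in> {x. \<exists>t. upd x i t \<in> ?T}" by blast
  qed (auto split: if_splits; metis)
  finally show ?case .
qed

section \<open>Decomposition into path connected pieces\<close>

definition finitely_path_connected :: "'a::topological_space set \<Rightarrow> bool" where
  "finitely_path_connected S \<longleftrightarrow> (\<exists>\<E>. finite \<E> \<and> (\<forall>E\<in>\<E>. path_connected E) \<and> S = \<Union>\<E>)"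

lemma finite_sign_classes:
  fixes H :: "('x \<Rightarrow> real) set"
  assumes "finite H"
  shows "finite (range (\<lambda>x. {z. \<forall>h\<in>H. sgn (h z) = sgn (h x)}))"
proof -
  have "range (\<lambda>x. {z. \<forall>h\<in>H. sgn (h z) = sgn (h x)}) \<subseteq>
      (\<lambda>s. {z. \<forall>h\<in>H. sgn (h z) = s h}) ` (\<Pi>\<^sub>E h\<in>H. {-1, 0, 1})"
  proof
    fix C assume "C \<in> range (\<lambda>x. {z. \<forall>h\<in>H. sgn (h z) = sgn (h x)})"
    then obtain x where "C = {z. \<forall>h\<in>H. sgn (h z) = sgn (h x)}" by auto
    then show "C \<in> (\<lambda>s. {z. \<forall>h\<in>H. sgn (h z) = s h}) ` (\<Pi>\<^sub>E h\<in>H. {-1, 0, 1})"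
      by (intro image_eqI[of _ _ "\<lambda>h\<in>H. sgn (h x)"]) (auto simp: sgn_real_def)
  qed
  then show ?thesis by (rule finite_subset) (use assms in \<open>auto intro!: finite_PiE\<close>)
qed

text \<open>
  The graph of a continuous section in the given position is path connected, and every vertical fibre
  is an interval that meets this graph.
\<close>

lemma path_connected_position:
  fixes D :: "'x::topological_space set"
  assumes R: "sections D R" and D: "path_connected D" and x0: "x0 \<in> D"
  shows "path_connected {(x, y). x \<in> D \<and> same_position R x0 y0 x y}" (is "path_connected ?T")
proof -
  obtain m where m: "continuous_on D m" "\<And>x. x \<in> D \<Longrightarrow> same_position R x0 y0 x (m x)"
    using section_through[OF R x0] by blast
  define G where "G = (\<lambda>x. (x, m x)) ` D"
  define V where "V x = Pair x ` {y. same_position R x0 y0 x y}" for x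
  have G: "path_connected G"
    unfolding G_def using m(1) by (intro path_connected_continuous_image D continuous_intros)
  have V: "path_connected (V x)" for x
    unfolding V_def
  proof (intro path_connected_continuous_image continuous_intros)
    have "is_interval {y. same_position R x0 y0 x y}"
      unfolding is_interval_1 by (auto intro: same_position_between)
    then show "path_connected {y. same_position R x0 y0 x y}" by (rule is_interval_path_connected)
  qed
  have "?T = (\<Union>x\<in>D. G \<union> V x)" using m(2) unfolding G_def V_def by auto
  also have "path_connected \<dots>"
  proof (rule path_connected_UNION)
    show "path_connected (G \<union> V x)" if "x \<in> D" for x
      using that m(2) by (intro path_connected_Un G V) (auto simp: G_def V_def)
    show "(x0, m x0) \<in> G \<union> V x" for x using x0 by (auto simp: G_def)
  qed
  finally show ?thesis .
qed

text \<open>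
  By the induction hypothesis the sign classes of the slicing functions split into finitely many path
  connected sets \<open>E\<close>. Over each of them there are finitely many positions, and these cut the product of
  \<open>E\<close> with the line into path connected pieces. Since \<open>E\<close> and the sections over it may depend on the
  coordinate \<open>i\<close> of \<open>x\<close>, the pieces are formed in the product space and mapped back by
  \<open>(x, y) \<mapsto> upd x i y\<close>. The polynomials that define \<open>S\<close> have constant signs on the image of a piece, so
  \<open>S\<close> is the union of the images that start at one of its points.
\<close>

lemma finitely_path_connected_cylinder:
  fixes S :: "(real ^ 'k::finite) set"
  assumes IH: "\<And>S. definable (poly_in I) S \<Longrightarrow> finitely_path_connected S"
    and S: "definable (poly_in (insert i I)) S" and i: "i \<notin> I"
  shows "finitely_path_connected S"
proof -
  obtain L where L: "finite L" "L \<subseteq> poly_in (insert i I)"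
    "\<And>x x'. (\<forall>h\<in>L. sgn (h x) = sgn (h x')) \<Longrightarrow> x \<in> S \<Longrightarrow> x' \<in> S"
    using S unfolding definable_def by blast
  obtain H where H: "finite H" "H \<subseteq> poly_in I" and
    R: "\<And>D. const_sign H D \<Longrightarrow> \<exists>R. sections D R \<and> (\<forall>x\<in>D. \<forall>x'\<in>D. \<forall>y y'. same_position R x y x' y' \<longrightarrow>
      (\<forall>f\<in>L. sgn (f (upd x i y)) = sgn (f (upd x' i y'))))"
    using cylinder_slicing[OF L(1,2) i] by metis
  define C where "C x = {z. \<forall>h\<in>H. sgn (h z) = sgn (h x)}" for x
  have finC: "finite (range C)" unfolding C_def by (rule finite_sign_classes[OF H(1)])
  have "\<forall>D\<in>range C. \<exists>\<E>. finite \<E> \<and> (\<forall>E\<in>\<E>. path_connected E) \<and> D = \<Union>\<E>"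
  proof
    fix D assume "D \<in> range C"
    then obtain x where D: "D = C x" by blast
    have "definable (poly_in I) D"
      unfolding definable_def D C_def using H by (intro exI[of _ H]) auto
    from IH[OF this] show "\<exists>\<E>. finite \<E> \<and> (\<forall>E\<in>\<E>. path_connected E) \<and> D = \<Union>\<E>"
      by (simp add: finitely_path_connected_def)
  qed
  then obtain \<E> where \<E>: "\<And>D. D \<in> range C \<Longrightarrow> finite (\<E> D)"
    "\<And>D E. D \<in> range C \<Longrightarrow> E \<in> \<E> D \<Longrightarrow> path_connected E" "\<And>D. D \<in> range C \<Longrightarrow> D = \<Union>(\<E> D)"
    by metis
  define \<F> where "\<F> = (\<Union>D\<in>range C. \<E> D)"
  have \<F>: "finite \<F>" "\<And>E. E \<in> \<F> \<Longrightarrow> path_connected E"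
    unfolding \<F>_def using finC \<E>(1,2) by (blast intro: finite_UN_I)+
  have cover: "\<exists>E\<in>\<F>. x \<in> E" for x
  proof -
    have "x \<in> C x" by (simp add: C_def)
    then show ?thesis using \<E>(3)[of "C x"] unfolding \<F>_def by blast
  qed
  have "\<forall>E\<in>\<F>. \<exists>R. sections E R \<and> (\<forall>x\<in>E. \<forall>x'\<in>E. \<forall>y y'. same_position R x y x' y' \<longrightarrow>
      (\<forall>f\<in>L. sgn (f (upd x i y)) = sgn (f (upd x' i y'))))"
  proof
    fix E assume "E \<in> \<F>"
    then obtain x where "E \<subseteq> C x" using \<E>(3) unfolding \<F>_def by blast
    then have "const_sign H E" unfolding const_sign_def C_def by (simp add: subset_iff)
    then show "\<exists>R. sections E R \<and> (\<forall>x\<in>E. \<forall>x'\<in>E. \<forall>y y'. same_position R x y x' y' \<longrightarrow>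
      (\<forall>f\<in>L. sgn (f (upd x i y)) = sgn (f (upd x' i y'))))" by (rule R)
  qed
  then obtain R where R: "\<And>E. E \<in> \<F> \<Longrightarrow> sections E (R E)"
    "\<And>E x x' y y'. E \<in> \<F> \<Longrightarrow> x \<in> E \<Longrightarrow> x' \<in> E \<Longrightarrow> same_position (R E) x y x' y' \<Longrightarrow>
      \<forall>f\<in>L. sgn (f (upd x i y)) = sgn (f (upd x' i y'))" by metis
  define T where "T E x0 y0 = (\<lambda>(x, y). upd x i y) ` {(x, y). x \<in> E \<and> same_position (R E) x0 y0 x y}"
    for E x0 y0
  define \<T> where "\<T> = (\<Union>E\<in>\<F>. {T E x0 y0 |x0 y0. x0 \<in> E \<and> upd x0 i y0 \<in> S})"
  have "finite {T E x0 y0 |x0 y0. x0 \<in> E \<and> upd x0 i y0 \<in> S}" if E: "E \<in> \<F>" for E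
  proof (rule finite_subset)
    \<comment> \<open>Positions over \<open>E\<close> are sign classes of the functions \<open>(x, y) \<mapsto> y - r x\<close> with \<open>r \<in> R E\<close>.\<close>
    show "{T E x0 y0 |x0 y0. x0 \<in> E \<and> upd x0 i y0 \<in> S} \<subseteq>
      (\<lambda>Z. (\<lambda>(x, y). upd x i y) ` {(x, y). x \<in> E \<and> (x, y) \<in> Z}) `
        range (\<lambda>z. {z'. \<forall>h\<in>(\<lambda>r (x, y). y - r x) ` R E. sgn (h z') = sgn (h z)})"
    proof
      fix U assume "U \<in> {T E x0 y0 |x0 y0. x0 \<in> E \<and> upd x0 i y0 \<in> S}"
      then obtain x0 y0 where U: "U = T E x0 y0" by blast
      have "same_position (R E) x0 y0 x y \<longleftrightarrow>
          (\<forall>h\<in>(\<lambda>r (x, y). y - r x) ` R E. sgn (h (x, y)) = sgn (h (x0, y0)))" for x y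
        unfolding same_position_def by force
      then show "U \<in> (\<lambda>Z. (\<lambda>(x, y). upd x i y) ` {(x, y). x \<in> E \<and> (x, y) \<in> Z}) `
        range (\<lambda>z. {z'. \<forall>h\<in>(\<lambda>r (x, y). y - r x) ` R E. sgn (h z') = sgn (h z)})"
        unfolding U T_def by (intro image_eqI[OF _ rangeI[of _ "(x0, y0)"]]) simp
    qed
    have "finite (R E)" using R(1)[OF E] by (simp add: sections_def)
    then show "finite ((\<lambda>Z. (\<lambda>(x, y). upd x i y) ` {(x, y). x \<in> E \<and> (x, y) \<in> Z}) `
        range (\<lambda>z. {z'. \<forall>h\<in>(\<lambda>r (x, y). y - r x) ` R E. sgn (h z') = sgn (h z)}))"
      by (intro finite_imageI finite_sign_classes)
  qed
  then have "finite \<T>" unfolding \<T>_def using \<F>(1) by auto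
  moreover have "path_connected U" if "U \<in> \<T>" for U
  proof -
    obtain E x0 y0 where U: "U = T E x0 y0" "E \<in> \<F>" "x0 \<in> E" using \<open>U \<in> \<T>\<close> unfolding \<T>_def by blast
    have "continuous_on X (\<lambda>(x, y). upd x i y)" for X
    proof -
      have "continuous_on X (\<lambda>z. \<chi> j. if j = i then snd z else fst z $ j)"
      proof (rule continuous_on_vec_lambda)
        show "continuous_on X (\<lambda>z. if j = i then snd z else fst z $ j)" for j
          by (cases "j = i") (auto intro!: continuous_intros)
      qed
      then show ?thesis unfolding upd_def case_prod_beta .
    qed
    then show ?thesis
      unfolding U(1) T_def
      by (rule path_connected_continuous_image) (rule path_connected_position[OF R(1)[OF U(2)] \<F>(2)[OF U(2)] U(3)])
  qed
  moreover have "S = \<Union>\<T>"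
  proof (intro equalityI subsetI)
    fix z assume z: "z \<in> S"
    obtain E where E: "E \<in> \<F>" "z \<in> E" using cover by blast
    have "z = (\<lambda>(x, y). upd x i y) (z, z $ i)" by simp
    then have "z \<in> T E z (z $ i)"
      unfolding T_def using E(2) by (intro image_eqI[of _ _ "(z, z $ i)"]) auto
    moreover have "T E z (z $ i) \<in> {T E x0 y0 |x0 y0. x0 \<in> E \<and> upd x0 i y0 \<in> S}"
      using E(2) z by (intro CollectI exI[of _ z] exI[of _ "z $ i"]) simp
    ultimately show "z \<in> \<Union>\<T>" unfolding \<T>_def using E(1) by blast
  next
    fix z assume "z \<in> \<Union>\<T>"
    then obtain E x0 y0 where E: "E \<in> \<F>" "x0 \<in> E" "upd x0 i y0 \<in> S" "z \<in> T E x0 y0"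
      unfolding \<T>_def by blast
    then obtain x y where xy: "z = upd x i y" "x \<in> E" "same_position (R E) x0 y0 x y"
      unfolding T_def by auto
    show "z \<in> S" unfolding xy(1) by (rule L(3)[OF R(2)[OF E(1,2) xy(2,3)] E(3)])
  qed
  ultimately show ?thesis unfolding finitely_path_connected_def by blast
qed

theorem definable_finitely_path_connected:
  fixes S :: "(real ^ 'k::finite) set"
  assumes "definable (poly_in I) S"
  shows "finitely_path_connected S"
  using finite[of I] assms
proof (induction I arbitrary: S rule: finite_induct)
  case empty
  then obtain H where H: "H \<subseteq> poly_in {}"
    "\<And>x x'. (\<forall>h\<in>H. sgn (h x) = sgn (h x')) \<Longrightarrow> x \<in> S \<Longrightarrow> x' \<in> S"
    unfolding definable_def by blast
  have "x' \<in> S" if "x \<in> S" for x x'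
  proof (rule H(2)[OF _ that])
    have "h x = h x'" if "h \<in> H" for h
      by (rule poly_in_cong[of h "{}"]) (use H(1) that in auto)
    then show "\<forall>h\<in>H. sgn (h x) = sgn (h x')" by metis
  qed
  then have "S = {} \<or> S = UNIV" by blast
  then show ?case
    unfolding finitely_path_connected_def
    by (intro exI[of _ "{S}"]) (auto simp: convex_imp_path_connected)
next
  case (insert i I)
  show ?case
    by (rule finitely_path_connected_cylinder[OF insert.IH insert.prems insert.hyps(2)])
qed

section \<open>Components of locally finitely path connected sets\<close>

text \<open>
  Infinitely many paths whose images shrink to \<open>x\<close> are concatenated to a continuous map \<open>h\<close> on the half
  line with limit \<open>x\<close> at infinity; the substitution \<open>s \<mapsto> s / (1 - s)\<close> turns it into a path ending at \<open>x\<close>.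
\<close>

lemma path_component_limit:
  fixes E :: "nat \<Rightarrow> 'a::metric_space set"
  assumes E: "\<And>k. path_connected (E k)" and p: "\<And>k. p k \<in> E k" "\<And>k. p (Suc k) \<in> E k"
    and sub: "\<And>k. E k \<subseteq> S" and x: "x \<in> S"
    and lim: "\<And>e. e > 0 \<Longrightarrow> \<exists>K. \<forall>k\<ge>K. E k \<subseteq> ball x e"
  shows "path_component S (p 0) x"
proof -
  have "\<exists>g. path g \<and> path_image g \<subseteq> E k \<and> pathstart g = p k \<and> pathfinish g = p (Suc k)" for k
    using E[of k] p[of k] unfolding path_connected_def by blast
  then obtain g where g: "\<And>k. path (g k)" "\<And>k. path_image (g k) \<subseteq> E k"
    "\<And>k. g k 0 = p k" "\<And>k. g k 1 = p (Suc k)" unfolding pathstart_def pathfinish_def by metis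
  define h where "h t = g (nat \<lfloor>t\<rfloor>) (frac t)" for t :: real
  have h_eq: "h t = g k (t - real k)" if "t \<in> {real k..real (Suc k)}" for k t
  proof (cases "t = real (Suc k)")
    case True
    have "h (real (Suc k)) = g (Suc k) 0" by (simp add: h_def frac_def del: of_nat_Suc)
    then show ?thesis using True g(3)[of "Suc k"] g(4)[of k] by simp
  next
    case False
    then have "\<lfloor>t\<rfloor> = int k" using that by (simp add: floor_eq_iff)
    then show ?thesis by (simp add: h_def frac_def)
  qed
  have h_in: "h t \<in> E (nat \<lfloor>t\<rfloor>)" for t
    using g(2)[of "nat \<lfloor>t\<rfloor>"] frac_ge_0[of t] frac_lt_1[of t]
    unfolding h_def path_image_def by (meson atLeastAtMost_iff image_subset_iff less_imp_le)
  have piece: "continuous_on {real k..real (Suc k)} h" for k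
  proof -
    have "continuous_on {real k..real (Suc k)} (\<lambda>t. g k (t - real k))"
      using g(1)[of k] unfolding path_def
      by (rule continuous_on_compose2) (auto intro!: continuous_intros)
    then show ?thesis by (rule continuous_on_eq) (rule h_eq[symmetric])
  qed
  have initial: "continuous_on {0..real n} h" for n
  proof (induction n)
    case (Suc n)
    have "{0..real (Suc n)} = {0..real n} \<union> {real n..real (Suc n)}" by auto
    then show ?case using continuous_on_closed_Un[OF _ _ Suc piece[of n]] by simp
  qed simp
  have cont_h: "continuous_on {0..} h"
    unfolding continuous_on_def
  proof
    fix t :: real assume t: "t \<in> {0..}"
    obtain n :: nat where n: "t < real n" using reals_Archimedean2 by blast
    have "(h \<longlongrightarrow> h t) (at t within {0..real n})"
      using initial[of n] t n unfolding continuous_on_def by simp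
    moreover have "at t within {0..real n} = at t within {0..}"
      by (rule at_within_nhd[of _ "{..<real n}"]) (use n in auto)
    ultimately show "(h \<longlongrightarrow> h t) (at t within {0..})" by simp
  qed
  define f where "f s = (if s < 1 then h (s / (1 - s)) else x)" for s :: real
  have cont_f1: "continuous_on {0..<1} f"
  proof -
    have "continuous_on {0..<1} (\<lambda>s::real. h (s / (1 - s)))"
      by (rule continuous_on_compose2[OF cont_h]) (auto intro!: continuous_intros)
    then show ?thesis by (rule continuous_on_eq) (simp add: f_def)
  qed
  have "continuous_on {0..1} f"
    unfolding continuous_on_def
  proof
    fix s :: real assume s: "s \<in> {0..1}"
    show "(f \<longlongrightarrow> f s) (at s within {0..1})"
    proof (cases "s < 1")
      case True
      have "(f \<longlongrightarrow> f s) (at s within {0..<1})"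
        using cont_f1 s True unfolding continuous_on_def by simp
      moreover have "at s within {0..<1} = at s within {0..1}"
        by (rule at_within_nhd[of _ "{..<1}"]) (use True in auto)
      ultimately show ?thesis by simp
    next
      case False
      then have s1: "s = 1" using s by simp
      show ?thesis
      proof (rule tendstoI)
        fix e :: real assume "e > 0"
        then obtain K where K: "\<And>k. k \<ge> K \<Longrightarrow> E k \<subseteq> ball x e" using lim by blast
        define c where "c = real K / (real K + 1)"
        have "c < s" unfolding c_def s1 by simp
        then have "\<forall>\<^sub>F u in at s within {0..1}. c < u"
          using order_tendstoD(1)[OF tendsto_ident_at] by blast
        moreover have "\<forall>\<^sub>F u in at s within {0..1}. u \<in> {0..1} \<and> u \<noteq> s"
          by (simp add: eventually_at_filter)
        ultimately show "\<forall>\<^sub>F u in at s within {0..1}. dist (f u) (f s) < e"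
        proof eventually_elim
          case (elim u)
          then have u: "u < 1" "c < u" using s1 by auto
          then have "real K \<le> u / (1 - u)" unfolding c_def by (simp add: field_simps)
          then have "K \<le> nat \<lfloor>u / (1 - u)\<rfloor>" by (simp add: le_nat_iff le_floor_iff)
          then have "h (u / (1 - u)) \<in> ball x e" using h_in K by blast
          then show ?case using u s1 by (simp add: f_def dist_commute)
        qed
      qed
    qed
  qed
  moreover have "f ` {0..1} \<subseteq> S"
    using h_in sub x by (auto simp: f_def)
  moreover have "f 0 = p 0" using g(3)[of 0] by (simp add: f_def h_def)
  moreover have "f 1 = x" by (simp add: f_def)
  ultimately show ?thesis
    unfolding path_component_def path_def path_image_def pathstart_def pathfinish_def by blast
qed

text \<open>
  The closure of a finite union is the union of the closures.
\<close>

lemma closure_piece: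
  fixes D :: "'a::metric_space set"
  assumes D: "D \<subseteq> S" "x \<in> closure D" and fin: "finitely_path_connected (S \<inter> ball x e)" and e: "e > 0"
  shows "\<exists>E. path_connected E \<and> E \<subseteq> S \<inter> ball x e \<and> x \<in> closure (D \<inter> E)"
proof -
  from fin obtain \<E> where "finite \<E> \<and> (\<forall>E\<in>\<E>. path_connected E) \<and> S \<inter> ball x e = \<Union>\<E>"
    unfolding finitely_path_connected_def ..
  then have \<E>: "finite \<E>" "\<And>E. E \<in> \<E> \<Longrightarrow> path_connected E" "S \<inter> ball x e = \<Union>\<E>" by simp_all
  have "x \<in> closure (ball x e \<inter> D)"
    using open_Int_closure_subset[of "ball x e" D] D(2) e by auto
  also have "ball x e \<inter> D = \<Union>((\<lambda>E. D \<inter> E) ` \<E>)" using \<E>(3) D(1) by blast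
  also have "closure \<dots> = \<Union>(closure ` (\<lambda>E. D \<inter> E) ` \<E>)"
    using closure_of_Union[of "(\<lambda>E. D \<inter> E) ` \<E>" euclidean] \<E>(1) by simp
  finally obtain E where "E \<in> \<E>" "x \<in> closure (D \<inter> E)" by blast
  then show ?thesis using \<E>(2,3) by (intro exI[of _ E]) blast
qed

text \<open>
  Choose pieces \<open>E k\<close> of \<open>S \<inter> ball x (1 / (k + 1))\<close> and decreasing sets \<open>D k \<subseteq> P\<close> with \<open>D k \<subseteq> E k\<close> and \<open>x\<close>
  in the closure of \<open>D k\<close>, cutting the previous \<open>D k\<close> with a piece of the next smaller ball. Points
  \<open>p k \<in> D k\<close> then satisfy \<open>p k, p (k + 1) \<in> E k\<close>, so consecutive points are joined inside \<open>E k\<close>.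
\<close>

lemma path_component_of_closure_point:
  fixes S :: "'a::metric_space set"
  assumes loc: "\<And>e. e > 0 \<Longrightarrow> finitely_path_connected (S \<inter> ball x e)"
    and P: "P \<subseteq> S" "x \<in> closure P" and x: "x \<in> S"
  shows "\<exists>p\<in>P. path_component S p x"
proof -
  define good where "good k DE \<longleftrightarrow> fst DE \<subseteq> P \<inter> snd DE \<and> x \<in> closure (fst DE) \<and>
      path_connected (snd DE) \<and> snd DE \<subseteq> S \<inter> ball x (inverse (real (Suc k)))" for k DE
  have ext: "\<exists>DE'. good k DE' \<and> fst DE' \<subseteq> D" if D: "D \<subseteq> P" "x \<in> closure D" for D k
  proof -
    have "D \<subseteq> S" using D P by blast
    from closure_piece[OF this D(2) loc, of "inverse (real (Suc k))"]
    obtain E where "path_connected E" "E \<subseteq> S \<inter> ball x (inverse (real (Suc k)))" "x \<in> closure (D \<inter> E)"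
      by auto
    then show ?thesis using D unfolding good_def by (intro exI[of _ "(D \<inter> E, E)"]) auto
  qed
  have "\<exists>DE. \<forall>k. good k (DE k) \<and> fst (DE (Suc k)) \<subseteq> fst (DE k)"
  proof (rule dependent_nat_choice)
    show "\<exists>DE. good 0 DE" using ext[OF order_refl P(2)] by blast
    show "\<exists>DE'. good (Suc k) DE' \<and> fst DE' \<subseteq> fst DE" if "good k DE" for DE k
      using that by (intro ext) (auto simp: good_def)
  qed
  then obtain DE where DE: "\<And>k. good k (DE k)" "\<And>k. fst (DE (Suc k)) \<subseteq> fst (DE k)" by blast
  define E where "E k = snd (DE k)" for k
  have "\<exists>p. p \<in> fst (DE k)" for k
    using DE(1)[of k] unfolding good_def by (metis closure_empty empty_iff ex_in_conv)
  then obtain p where p: "\<And>k. p k \<in> fst (DE k)" by metis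
  have E: "path_connected (E k)" "fst (DE k) \<subseteq> P \<inter> E k" "E k \<subseteq> S"
    "E k \<subseteq> ball x (inverse (real (Suc k)))" for k
    using DE(1)[of k] unfolding good_def E_def by auto
  have "path_component S (p 0) x"
  proof (rule path_component_limit[of E])
    show "p k \<in> E k" "p (Suc k) \<in> E k" for k
      using p[of k] p[of "Suc k"] DE(2)[of k] E(2)[of k] by auto
    show "\<exists>K. \<forall>k\<ge>K. E k \<subseteq> ball x e" if "e > 0" for e
    proof -
      obtain K where K: "inverse (real (Suc K)) < e" using reals_Archimedean[OF \<open>e > 0\<close>] by blast
      have "E k \<subseteq> ball x e" if "k \<ge> K" for k
      proof -
        have "inverse (real (Suc k)) \<le> inverse (real (Suc K))"
          using that by (intro le_imp_inverse_le) auto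
        then have "ball x (inverse (real (Suc k))) \<subseteq> ball x e" using K by (intro subset_ball) linarith
        then show ?thesis using E(4)[of k] by blast
      qed
      then show ?thesis by blast
    qed
  qed (use E x in auto)
  then show ?thesis using p[of 0] E(2)[of 0] by blast
qed

text \<open>
  A path component and its complement in the component are both relatively closed: a point of \<open>S\<close> in
  the closure of a subset of \<open>S\<close> can be joined to a point of this subset.
\<close>

theorem components_path_connected_finite:
  fixes S :: "'a::metric_space set"
  assumes fin: "finitely_path_connected S"
    and loc: "\<And>x e. x \<in> S \<Longrightarrow> e > 0 \<Longrightarrow> finitely_path_connected (S \<inter> ball x e)"
  shows "finite (components S)" "\<And>C. C \<in> components S \<Longrightarrow> path_connected C"
proof -
  from fin obtain \<E> where "finite \<E> \<and> (\<forall>E\<in>\<E>. path_connected E) \<and> S = \<Union>\<E>"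
    unfolding finitely_path_connected_def ..
  then have \<E>: "finite \<E>" "\<And>E. E \<in> \<E> \<Longrightarrow> path_connected E" "S = \<Union>\<E>" by simp_all
  have "components S \<subseteq> (\<lambda>E. connected_component_set S (SOME e. e \<in> E)) ` \<E>"
  proof
    fix C assume "C \<in> components S"
    then obtain x where x: "x \<in> S" "C = connected_component_set S x" by (auto simp: components_def)
    then obtain E where E: "E \<in> \<E>" "x \<in> E" using \<E>(3) by blast
    then have "(SOME e. e \<in> E) \<in> E" by (metis someI)
    moreover have "connected E" "E \<subseteq> S" using E \<E> path_connected_imp_connected by auto
    ultimately have "connected_component S x (SOME e. e \<in> E)"
      using E(2) unfolding connected_component_def by blast
    then have "C = connected_component_set S (SOME e. e \<in> E)"
      using x(2) connected_component_eq by (metis mem_Collect_eq)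
    then show "C \<in> (\<lambda>E. connected_component_set S (SOME e. e \<in> E)) ` \<E>" using E(1) by blast
  qed
  then show "finite (components S)" using \<E>(1) finite_subset by blast
next
  fix C assume C: "C \<in> components S"
  have CS: "C \<subseteq> S" "connected C" using C in_components_subset in_components_connected by auto
  show "path_connected C"
    unfolding path_connected_component
  proof (intro ballI)
    fix x y assume x: "x \<in> C" and y: "y \<in> C"
    define A where "A = path_component_set S x"
    define B where "B = C - A"
    have xA: "x \<in> A" using x CS unfolding A_def by (auto intro: path_component_refl)
    have "connected A" "A \<subseteq> S"
      unfolding A_def using path_connected_path_component path_connected_imp_connected path_component_subset by blast+
    then have AC: "A \<subseteq> C"
      using components_maximal[OF C] x xA by blast
    have cl: "z \<in> A \<longleftrightarrow> (\<exists>p\<in>A. path_component S p z)" for z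
      using xA unfolding A_def by (auto intro: path_component_trans)
    have A_closed: "z \<in> A" if "z \<in> closure A" "z \<in> C" for z
      using path_component_of_closure_point[OF loc \<open>A \<subseteq> S\<close> that(1)] that CS cl by blast
    have B_closed: "z \<notin> A" if z: "z \<in> closure B" "z \<in> C" for z
    proof
      assume "z \<in> A"
      have "B \<subseteq> S" using CS B_def by blast
      then obtain p where "p \<in> B" "path_component S p z"
        using path_component_of_closure_point[OF loc _ z(1)] z CS by blast
      moreover have "path_component S x z" using \<open>z \<in> A\<close> by (simp add: A_def)
      ultimately have "p \<in> A"
        unfolding A_def mem_Collect_eq by (meson path_component_trans path_component_sym)
      with \<open>p \<in> B\<close> show False by (simp add: B_def)
    qed
    have "closure A \<inter> C = {} \<or> closure B \<inter> C = {}"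
    proof (rule connected_closedD[OF CS(2)])
      show "closure A \<inter> closure B \<inter> C = {}" using A_closed B_closed by blast
      show "C \<subseteq> closure A \<union> closure B" using closure_subset[of A] closure_subset[of B] B_def by blast
    qed auto
    then have "B = {}" using x xA closure_subset[of A] closure_subset[of B] B_def by blast
    then have "A = C" using AC B_def by blast
    then have "path_component A x y"
      using y xA path_connected_path_component[of S x] unfolding A_def path_connected_component by blast
    then show "path_component C x y" using \<open>A = C\<close> by simp
  qed
qed

section \<open>Semi-algebraic sets\<close>

lemma basic_semialgebraic_definable:
  assumes "basic_semialgebraic (B :: (real ^ 'k::finite) set)"
  shows "definable (poly_in UNIV) B"
proof -
  obtain P Q where PQ: "finite P" "finite Q" "\<And>f. f \<in> P \<Longrightarrow> real_polynomial_function f"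
    "\<And>g. g \<in> Q \<Longrightarrow> real_polynomial_function g"
    "B = {x. (\<forall>f\<in>P. f x = 0) \<and> (\<forall>g\<in>Q. g x < 0)}"
    using assms unfolding basic_semialgebraic_def by blast
  have "definable (poly_in UNIV) ((\<Inter>f\<in>P. {x. f x = 0}) \<inter> (\<Inter>g\<in>Q. {x. g x < 0}))"
    using PQ by (intro definable_Int definable_INT definable_zero definable_neg) (auto simp: poly_in_UNIV)
  also have "(\<Inter>f\<in>P. {x. f x = 0}) \<inter> (\<Inter>g\<in>Q. {x. g x < 0}) = B" unfolding PQ(5) by auto
  finally show ?thesis .
qed

lemma sign_class_basic_semialgebraic:
  fixes H :: "(real ^ 'k::finite \<Rightarrow> real) set"
  assumes "finite H" "\<And>h. h \<in> H \<Longrightarrow> real_polynomial_function h"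
  shows "basic_semialgebraic {z. \<forall>h\<in>H. sgn (h z) = sgn (h x)}"
proof -
  define P where "P = {h\<in>H. h x = 0}"
  define Q where "Q = {h\<in>H. h x < 0} \<union> (\<lambda>h z. - h z) ` {h\<in>H. h x > 0}"
  have "{z. \<forall>h\<in>H. sgn (h z) = sgn (h x)} = {z. (\<forall>f\<in>P. f z = 0) \<and> (\<forall>g\<in>Q. g z < 0)}"
  proof (intro equalityI subsetI CollectI)
    fix z assume "z \<in> {z. \<forall>h\<in>H. sgn (h z) = sgn (h x)}"
    then have z: "\<And>h. h \<in> H \<Longrightarrow> sgn (h z) = sgn (h x)" by blast
    have "h z = 0" if "h \<in> H" "h x = 0" for h using z[OF that(1)] that(2) by (simp add: sgn_zero_iff)
    moreover have "h z < 0" if "h \<in> H" "h x < 0" for h using z[OF that(1)] that(2) by (simp add: sgn_1_neg)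
    moreover have "h z > 0" if "h \<in> H" "h x > 0" for h using z[OF that(1)] that(2) by (simp add: sgn_1_pos)
    ultimately show "(\<forall>f\<in>P. f z = 0) \<and> (\<forall>g\<in>Q. g z < 0)" unfolding P_def Q_def by auto
  next
    fix z assume z: "z \<in> {z. (\<forall>f\<in>P. f z = 0) \<and> (\<forall>g\<in>Q. g z < 0)}"
    have "sgn (h z) = sgn (h x)" if "h \<in> H" for h
    proof -
      have "h x = 0 \<Longrightarrow> h z = 0" "h x < 0 \<Longrightarrow> h z < 0"
        using z that unfolding P_def Q_def by auto
      moreover have "(\<lambda>z. - h z) \<in> Q" if "h x > 0"
        using that \<open>h \<in> H\<close> unfolding Q_def by blast
      then have "h x > 0 \<Longrightarrow> h z > 0" using z by fastforce
      ultimately show ?thesis by (cases "h x" "0::real" rule: linorder_cases) auto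
    qed
    then show "\<forall>h\<in>H. sgn (h z) = sgn (h x)" by blast
  qed
  moreover have "finite P" "finite Q" using assms(1) by (auto simp: P_def Q_def)
  moreover have "real_polynomial_function (\<lambda>z. - h z)" if "h \<in> H" for h
    using assms(2)[OF that] by (rule real_polynomial_function_minus)
  then have "\<forall>f\<in>P. real_polynomial_function f" "\<forall>g\<in>Q. real_polynomial_function g"
    using assms(2) by (auto simp: P_def Q_def)
  ultimately show ?thesis unfolding basic_semialgebraic_def by blast
qed

lemma semialgebraic_iff_definable:
  fixes S :: "(real ^ 'k::finite) set"
  shows "semialgebraic S \<longleftrightarrow> definable (poly_in UNIV) S"
proof
  assume "semialgebraic S"
  then obtain \<B> where \<B>: "finite \<B>" "\<And>B. B \<in> \<B> \<Longrightarrow> basic_semialgebraic B" "S = \<Union>\<B>"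
    unfolding semialgebraic_def by blast
  have "definable (poly_in UNIV) (\<Union>B\<in>\<B>. B)"
    using \<B>(1,2) by (intro definable_UN basic_semialgebraic_definable)
  then show "definable (poly_in UNIV) S" by (simp add: \<B>(3))
next
  assume "definable (poly_in UNIV) S"
  then obtain H where H: "finite H" "H \<subseteq> poly_in UNIV"
    "\<And>x x'. (\<forall>h\<in>H. sgn (h x) = sgn (h x')) \<Longrightarrow> x \<in> S \<Longrightarrow> x' \<in> S"
    unfolding definable_def by blast
  define C where "C x = {z. \<forall>h\<in>H. sgn (h z) = sgn (h x)}" for x
  have "finite (range C)" unfolding C_def by (rule finite_sign_classes[OF H(1)])
  then have "finite (C ` S)" by (rule finite_subset[rotated]) auto
  moreover have "\<forall>B\<in>C ` S. basic_semialgebraic B"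
    using H(2) sign_class_basic_semialgebraic[OF H(1)] unfolding C_def poly_in_UNIV by blast
  moreover have "S = \<Union>(C ` S)"
  proof (intro equalityI subsetI)
    fix z assume "z \<in> \<Union>(C ` S)"
    then obtain x where x: "x \<in> S" "\<forall>h\<in>H. sgn (h z) = sgn (h x)" unfolding C_def by blast
    then have "\<forall>h\<in>H. sgn (h x) = sgn (h z)" by metis
    from H(3)[OF this x(1)] show "z \<in> S" .
  qed (auto simp: C_def)
  ultimately show "semialgebraic S" unfolding semialgebraic_def by blast
qed

lemma definable_ball:
  fixes x :: "real ^ 'k::finite"
  assumes "e > 0"
  shows "definable (poly_in UNIV) (ball x e)"
proof -
  interpret function_ring "poly_in (UNIV :: 'k set)" by (rule function_ring_poly_in)
  have "(\<lambda>z. x $ j - z $ j) \<in> poly_in UNIV" for j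
    by (rule diff[OF poly_in.const poly_in.coord]) simp
  then have "(\<lambda>z. (\<Sum>j\<in>UNIV. (x $ j - z $ j) * (x $ j - z $ j)) - e * e) \<in> poly_in UNIV"
    by (intro diff[OF sum[OF finite mult] poly_in.const])
  then have "definable (poly_in UNIV) {z. (\<Sum>j\<in>UNIV. (x $ j - z $ j) * (x $ j - z $ j)) - e * e < 0}"
    by (rule definable_neg)
  also have "{z. (\<Sum>j\<in>UNIV. (x $ j - z $ j) * (x $ j - z $ j)) - e * e < 0} = ball x e"
  proof -
    have "(\<Sum>j\<in>UNIV. (x $ j - z $ j) * (x $ j - z $ j)) = (dist x z)\<^sup>2" for z
      by (simp add: dist_norm power2_norm_eq_inner inner_vec_def)
    moreover have "(dist x z)\<^sup>2 < e\<^sup>2 \<longleftrightarrow> dist x z < e" for z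
      using assms by (metis abs_of_nonneg abs_of_pos power2_less_imp_less power_strict_mono zero_le_dist less_imp_le pos2)
    ultimately show ?thesis by (auto simp: power2_eq_square)
  qed
  finally show ?thesis .
qed

theorem semialgebraic_components:
  fixes S :: "(real ^ 'k::finite) set"
  assumes "semialgebraic S"
  shows "finite (components S)" "\<And>C. C \<in> components S \<Longrightarrow> path_connected C"
proof -
  have S: "definable (poly_in UNIV) S" using assms semialgebraic_iff_definable by blast
  have 1: "finitely_path_connected S" by (rule definable_finitely_path_connected[OF S])
  have 2: "finitely_path_connected (S \<inter> ball x e)" if "e > 0" for x e
    using definable_finitely_path_connected[OF definable_Int[OF S definable_ball[OF that]]] .
  show "finite (components S)"
    using components_path_connected_finite(1)[OF 1 2] .
  show "path_connected C" if "C \<in> components S" for C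
    using components_path_connected_finite(2)[OF 1 2 that] .
qed

lemma poly_in_compose:
  assumes "f \<in> poly_in UNIV" "\<And>i. (\<lambda>z. q z $ i) \<in> poly_in UNIV"
  shows "(\<lambda>z. f (q z)) \<in> poly_in UNIV"
  using assms(1) by (induction rule: poly_in.induct) (auto intro: poly_in.intros assms(2))

lemma definable_vimage:
  fixes S :: "(real ^ 'k::finite) set"
  assumes S: "definable (poly_in UNIV) S" and q: "\<And>i. (\<lambda>z. q z $ i) \<in> poly_in UNIV"
  shows "definable (poly_in UNIV) {z. q z \<in> S}"
proof -
  obtain H where H: "finite H" "H \<subseteq> poly_in UNIV"
    "\<And>x x'. (\<forall>h\<in>H. sgn (h x) = sgn (h x')) \<Longrightarrow> x \<in> S \<Longrightarrow> x' \<in> S"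
    using S unfolding definable_def by blast
  have "(\<lambda>h z. h (q z)) ` H \<subseteq> poly_in UNIV" using H(2) poly_in_compose[OF _ q] by blast
  then show ?thesis
    unfolding definable_def using H(1,3) by (intro exI[of _ "(\<lambda>h z. h (q z)) ` H"]) auto
qed

section \<open>The proper Pareto solution set\<close>

text \<open>
  A point of the space \<open>real ^ ('n + 'm + 'n)\<close> consists of a candidate solution, a weight vector and a
  test point of the variational inequality.
\<close>

definition x_part :: "real ^ ('n::finite + 'm::finite + 'n) \<Rightarrow> real ^ 'n" where
  "x_part z = (\<chi> j. z $ Inl j)"

definition w_part :: "real ^ ('n::finite + 'm::finite + 'n) \<Rightarrow> real ^ 'm" where
  "w_part z = (\<chi> l. z $ Inr (Inl l))"

definition y_part :: "real ^ ('n::finite + 'm::finite + 'n) \<Rightarrow> real ^ 'n" where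
  "y_part z = (\<chi> j. z $ Inr (Inr j))"

definition join :: "real ^ 'n \<Rightarrow> real ^ 'm \<Rightarrow> real ^ 'n \<Rightarrow> real ^ ('n::finite + 'm::finite + 'n)" where
  "join x w y = (\<chi> k. case k of Inl j \<Rightarrow> x $ j | Inr (Inl l) \<Rightarrow> w $ l | Inr (Inr j) \<Rightarrow> y $ j)"

lemma parts_join [simp]: "x_part (join x w y) = x" "w_part (join x w y) = w" "y_part (join x w y) = y"
  by (simp_all add: x_part_def w_part_def y_part_def join_def vec_eq_iff)

lemma agree_off_y:
  fixes z z' :: "real ^ ('n::finite + 'm::finite + 'n)"
  shows "(\<forall>k. k \<notin> range (\<lambda>j. Inr (Inr j)) \<longrightarrow> z' $ k = z $ k) \<longleftrightarrow> x_part z' = x_part z \<and> w_part z' = w_part z"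
  (is "?L \<longleftrightarrow> ?R")
proof
  assume ?R
  show ?L
  proof (intro allI impI)
    fix k :: "'n + 'm + 'n" assume k: "k \<notin> range (\<lambda>j. Inr (Inr j))"
    show "z' $ k = z $ k"
    proof (cases k)
      case (Inl j)
      then show ?thesis using \<open>?R\<close> by (auto simp: x_part_def vec_eq_iff)
    next
      case (Inr k')
      then obtain l where "k = Inr (Inl l)" using k by (cases k') auto
      then show ?thesis using \<open>?R\<close> by (auto simp: w_part_def vec_eq_iff)
    qed
  qed
qed (auto simp: x_part_def w_part_def vec_eq_iff image_iff)

lemma agree_off_w:
  fixes z z' :: "real ^ ('n::finite + 'm::finite + 'n)"
  shows "(\<forall>k. k \<notin> range (\<lambda>l. Inr (Inl l)) \<longrightarrow> z' $ k = z $ k) \<longleftrightarrow> x_part z' = x_part z \<and> y_part z' = y_part z"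
  (is "?L \<longleftrightarrow> ?R")
proof
  assume ?R
  show ?L
  proof (intro allI impI)
    fix k :: "'n + 'm + 'n" assume k: "k \<notin> range (\<lambda>l. Inr (Inl l))"
    show "z' $ k = z $ k"
    proof (cases k)
      case (Inl j)
      then show ?thesis using \<open>?R\<close> by (auto simp: x_part_def vec_eq_iff)
    next
      case (Inr k')
      then obtain j where "k = Inr (Inr j)" using k by (cases k') auto
      then show ?thesis using \<open>?R\<close> by (auto simp: y_part_def vec_eq_iff)
    qed
  qed
qed (auto simp: x_part_def y_part_def vec_eq_iff image_iff)

text \<open>
  The universal quantifier over the test point is a complement of a projection along the last block
  of coordinates, and the existential quantifier over the weights is a projection along the middle
  block. In both cases the remaining coordinates are kept as parameters; at the end the set is pulled
  back along the embedding \<open>x \<mapsto> (x, 0, 0)\<close>.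
\<close>

lemma semialgebraic_Sol_pr:
  fixes K :: "(real ^ 'n) set"
    and F :: "'m::finite \<Rightarrow> real ^ 'n \<Rightarrow> real ^ 'n"
  assumes K: "semialgebraic K" and F: "\<And>l j. polynomial_on K (\<lambda>x. F l x $ j)"
  shows "semialgebraic (Sol_pr F K)"
proof -
  let ?A = "poly_in (UNIV :: ('n + 'm + 'n) set)"
  interpret function_ring ?A by (rule function_ring_poly_in)
  have "\<forall>l j. \<exists>p. real_polynomial_function p \<and> (\<forall>x\<in>K. F l x $ j = p x)"
    using F unfolding polynomial_on_def by blast
  then obtain p where p: "\<And>l j. p l j \<in> poly_in UNIV" "\<And>l j x. x \<in> K \<Longrightarrow> F l x $ j = p l j x"
    unfolding poly_in_UNIV mem_Collect_eq by metis
  have Kd: "definable (poly_in UNIV) K" using K semialgebraic_iff_definable by blast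
  have xA: "(\<lambda>z. x_part z $ j) \<in> ?A" and yA: "(\<lambda>z. y_part z $ j) \<in> ?A" for j
    by (auto simp: x_part_def y_part_def intro: poly_in.coord)
  have wA: "(\<lambda>z. w_part z $ l) \<in> ?A" for l
    by (auto simp: w_part_def intro: poly_in.coord)
  define val where "val z = (\<Sum>j\<in>UNIV. (\<Sum>l\<in>UNIV. w_part z $ l * p l j (x_part z)) * (y_part z $ j - x_part z $ j))"
    for z :: "real ^ ('n + 'm + 'n)"
  have val: "val z = (\<Sum>l\<in>UNIV. w_part z $ l *\<^sub>R F l (x_part z)) \<bullet> (y_part z - x_part z)"
    if "x_part z \<in> K" for z
    unfolding val_def inner_vec_def using p(2)[OF that] by (simp add: sum_component)
  have valA: "val \<in> ?A"
    unfolding val_def using xA yA wA poly_in_compose[OF p(1) xA] by (intro sum mult diff) auto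
  define bad where "bad = {z. y_part z \<in> K} \<inter> {z. val z < 0}"
  have "definable ?A bad"
    unfolding bad_def by (intro definable_Int definable_vimage[OF Kd yA] definable_neg valA)
  from definable_ex_coordinates[OF this, of "range (\<lambda>j. Inr (Inr j))"]
  have "definable ?A {z. \<exists>z'\<in>bad. x_part z' = x_part z \<and> w_part z' = w_part z}"
    unfolding agree_off_y .
  moreover have "definable ?A {z. w_part z \<in> ri_simplex}"
  proof -
    have "(\<lambda>z. (\<Sum>l\<in>UNIV. w_part z $ l) - 1) \<in> ?A"
      using wA by (intro diff sum poly_in.const) auto
    then have "definable ?A ((\<Inter>l\<in>UNIV. {z. 0 < w_part z $ l}) \<inter> {z. (\<Sum>l\<in>UNIV. w_part z $ l) - 1 = 0})"
      by (intro definable_Int definable_INT definable_pos[OF wA] definable_zero) auto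
    also have "(\<Inter>l\<in>UNIV. {z. 0 < w_part z $ l}) \<inter> {z. (\<Sum>l\<in>UNIV. w_part z $ l) - 1 = 0} =
        {z. w_part z \<in> ri_simplex}"
      by (auto simp: ri_simplex_def std_simplex_def intro: less_imp_le)
    finally show ?thesis .
  qed
  moreover have "definable ?A {z. x_part z \<in> K}" by (rule definable_vimage[OF Kd xA])
  ultimately have "definable ?A ({z. x_part z \<in> K} \<inter> {z. w_part z \<in> ri_simplex} \<inter>
      - {z. \<exists>z'\<in>bad. x_part z' = x_part z \<and> w_part z' = w_part z})" (is "definable ?A ?good")
    by (intro definable_Int definable_Compl)
  define proj where "proj = {z. \<exists>z'\<in>?good. x_part z' = x_part z \<and> y_part z' = y_part (z :: real ^ ('n + 'm + 'n))}"
  from definable_ex_coordinates[OF \<open>definable ?A ?good\<close>, of "range (\<lambda>l. Inr (Inl l))"]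
  have E: "definable ?A proj"
    unfolding agree_off_w proj_def .
  have "definable (poly_in UNIV) {x. join x 0 0 \<in> proj}"
  proof (rule definable_vimage[OF E, where q = "\<lambda>x. join x 0 0"])
    show "(\<lambda>x. join x 0 0 $ k) \<in> poly_in UNIV" for k :: "'n + 'm + 'n"
      by (cases k rule: sum.exhaust) (auto simp: join_def intro: poly_in.intros split: sum.split)
  qed
  also have "{x. join x 0 0 \<in> proj} = Sol_pr F K"
  proof (intro equalityI subsetI)
    fix x assume "x \<in> {x. join x 0 0 \<in> proj}"
    then have "\<exists>z\<in>?good. x_part z = x" by (auto simp: proj_def)
    then obtain z where z: "x_part z \<in> K" "w_part z \<in> ri_simplex" "x_part z = x"
      "\<And>z'. z' \<in> bad \<Longrightarrow> x_part z' = x_part z \<Longrightarrow> w_part z' \<noteq> w_part z" by auto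
    have "(\<Sum>l\<in>UNIV. w_part z $ l *\<^sub>R F l x) \<bullet> (y - x) \<ge> 0" if y: "y \<in> K" for y
    proof -
      have "join x (w_part z) y \<notin> bad" using z(4)[of "join x (w_part z) y"] z(3) by auto
      then have "val (join x (w_part z) y) \<ge> 0" using y unfolding bad_def by auto
      then show ?thesis using val[of "join x (w_part z) y"] z(1,3) by simp
    qed
    then show "x \<in> Sol_pr F K" using z unfolding Sol_pr_def Sol_VI_def by blast
  next
    fix x assume "x \<in> Sol_pr F K"
    then obtain w where w: "w \<in> ri_simplex" "x \<in> K"
      "\<And>y. y \<in> K \<Longrightarrow> (\<Sum>l\<in>UNIV. w $ l *\<^sub>R F l x) \<bullet> (y - x) \<ge> 0"
      unfolding Sol_pr_def Sol_VI_def by blast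
    have "join x w 0 \<in> ?good"
      using w val unfolding bad_def by (auto simp: not_less[symmetric])
    then have "\<exists>z'\<in>?good. x_part z' = x \<and> y_part z' = (0 :: real ^ 'n)"
      by (intro bexI[of _ "join x w 0"]) auto
    then show "x \<in> {x. join x 0 0 \<in> proj}" by (simp add: proj_def)
  qed
  finally show ?thesis using semialgebraic_iff_definable by blast
qed

theorem theorem3p2:
  fixes K :: "(real ^ 'n) set"
    and F :: "'m::finite \<Rightarrow> real ^ 'n \<Rightarrow> real ^ 'n"
  assumes "K \<noteq> {}"
    and "semialgebraic K"
    and "\<And>l j. polynomial_on K (\<lambda>x. F l x $ j)"
  shows "semialgebraic (Sol_pr F K) \<and>
         finite (components (Sol_pr F K)) \<and>
         (\<forall>C \<in> components (Sol_pr F K). path_connected C)"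
proof (intro conjI ballI)
  show sol: "semialgebraic (Sol_pr F K)" by (rule semialgebraic_Sol_pr[OF assms(2,3)])
  show "finite (components (Sol_pr F K))" by (rule semialgebraic_components(1)[OF sol])
  show "path_connected C" if "C \<in> components (Sol_pr F K)" for C
    by (rule semialgebraic_components(2)[OF sol that])
qed

end
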